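(* Let $p\geq 1$ and $0\leq k<p$ be integers and let $\sigma=\mathrm{ReLU}^p$. For each $N$, let $b_i=-1+2(i-1)/N$ for $i=1,\dots,N$, and let $\mathbf{G}^{(k)}_\sigma\in\mathbb{R}^{N\times N}$ be the matrix with entries $$[\mathbf{G}^{(k)}_\sigma]_{i,j}=\int_{-1}^1 \sigma^{(k)}(x-b_i)\,\sigma^{(k)}(x-b_j)\,dx,\qquad i,j=1,\dots,N,$$ with eigenvalues $\lambda^{(k)}_1\geq\cdots\geq\lambda^{(k)}_N$. Then, as $N\to+\infty$, $$\frac{\lambda^{(k)}_j}{\lambda^{(k)}_N}\sim\frac{N^{2+2(p-k)}}{j^{2+2(p-k)}},\qquad j=1,\dots,N,$$ (i.e. this ratio is bounded above and below by positive constants, independent of $N$ and $j$, times $(N/j)^{2+2(p-k)}$). Consequently the condition number $\kappa(\mathbf{G}^{(k)}_\sigma)=\lambda^{(k)}_1/\lambda^{(k)}_N$ satisfies $\kappa(\mathbf{G}^{(k)}_\sigma)=\Theta(N^{2+2(p-k)})$: there exist constants $c>0$, $C>0$ and an integer $N_0$ such that $cN^{2+2(p-k)}\leq\kappa(\mathbf{G}^{(k)}_\sigma)\leq CN^{2+2(p-k)}$ for all $N\geq N_0$.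
   Context: $\mathrm{ReLU}^p(z)=(\max\{0,z\})^p$ and $\sigma^{(k)}$ denotes the $k$-th derivative of $\sigma$. *)

theory Defs
  imports "HOL-Analysis.Henstock_Kurzweil_Integration" "Jordan_Normal_Form.Char_Poly"
begin

definition relu_pow :: "nat \<Rightarrow> real \<Rightarrow> real" where
  "relu_pow p z = (max 0 z) ^ p"

text \<open>Breakpoints b_i = -1 + 2(i-1)/N, i = 1..N, here indexed from 0: b i = -1 + 2 i / N.\<close>
definition bpt :: "nat \<Rightarrow> nat \<Rightarrow> real" where
  "bpt N i = -1 + 2 * real i / real N"

definition gram :: "nat \<Rightarrow> nat \<Rightarrow> nat \<Rightarrow> real mat" where
  "gram p k N = mat N N (\<lambda>(i, j).
      integral {-1..1} (\<lambda>x. (deriv ^^ k) (relu_pow p) (x - bpt N i)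
                           * (deriv ^^ k) (relu_pow p) (x - bpt N j)))"

text \<open>Eigenvalues (with algebraic multiplicity) in non-increasing order, for a matrix
  whose characteristic polynomial splits over the reals (e.g. real symmetric).\<close>
definition eigvals_desc :: "real mat \<Rightarrow> real list" where
  "eigvals_desc A = (THE ls. sorted_wrt (\<ge>) ls \<and> char_poly A = (\<Prod>a\<leftarrow>ls. [:- a, 1:]))"

end

theory Submission
  imports Defs "Jordan_Normal_Form.Schur_Decomposition"
begin

text \<open>Put \<open>q = p - k\<close>. Up to a constant and after rescaling to unit knot spacing, the quadratic form
  of the Gram matrix is the squared \<open>L\<^sup>2\<close> norm of the spline
  \<open>f x = (\<Sum>i<N. a i * relu_pow q (x - i))\<close> on \<open>{0..N}\<close>. By the min-max principle it suffices to
  exhibit, for each \<open>j\<close>, good test spaces.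

  For the upper bound, cut the index set into about \<open>j / (q + 1)\<close> blocks of length
  \<open>L \<approx> (q + 1) * N / j\<close> and require that in each block the moments of order at most \<open>q\<close> of the
  coefficients vanish. Then \<open>f\<close> decouples into the blocks, and Cauchy-Schwarz in each block gives
  \<open>\<parallel>f\<parallel>\<^sup>2 \<le> L ^ (2 * q + 2) * \<parallel>a\<parallel>\<^sup>2\<close>.

  For the lower bound, superpose in \<open>j\<close> disjoint blocks of length about \<open>N / j\<close> translates of one
  bump whose coefficients annihilate polynomials of degree \<open>q\<close>. When \<open>N / j\<close> is bounded, one uses
  instead that \<open>\<parallel>a\<parallel> \<le> C * \<parallel>f\<parallel>\<close> for all \<open>a\<close>, because a finite difference of order \<open>q + 1\<close> of \<open>f\<close>
  across a single knot isolates the coefficient at that knot.\<close>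

section \<open>Finite differences\<close>

text \<open>Induction on the degree, splitting off one factor \<open>y + real k * h\<close>. The
  part with \<open>y\<close> falls to the induction hypothesis; in the other part the factor
  \<open>k\<close> is absorbed into the binomial coefficient, which lowers both the order of the
  difference and the degree by one.\<close>

lemma finite_difference_power_eq_0:
  fixes y h :: real
  assumes "\<nu> < r"
  shows "(\<Sum>k\<le>r. (-1) ^ k * real (r choose k) * (y + real k * h) ^ \<nu>) = 0"
  using assms
proof (induction \<nu> arbitrary: r y)
  case 0
  then show ?case
    using choose_alternating_sum[of r, where 'a = real] by simp
next
  case (Suc \<nu>)
  then obtain s where r: "r = Suc s" and s: "\<nu> < s"
    by (cases r) auto
  have "(\<Sum>k\<le>r. (-1) ^ k * real (r choose k) * (real k * (y + real k * h) ^ \<nu>))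
      = (\<Sum>k\<le>s. (-1) ^ Suc k * real (Suc s choose Suc k) * (real (Suc k) * (y + real (Suc k) * h) ^ \<nu>))"
    unfolding r by (subst sum.atMost_Suc_shift) simp
  also have "\<dots> = (\<Sum>k\<le>s. - real (Suc s) * ((-1) ^ k * real (s choose k) * ((y + h) + real k * h) ^ \<nu>))"
  proof (rule sum.cong[OF refl])
    fix k
    have *: "(- e) * c' * (k' * z) = - s' * (e * c * z)" if "c' * k' = s' * c" for c c' k' s' e z :: real
    proof -
      have "(- e) * c' * (k' * z) = - (e * z * (c' * k'))"
        by (simp add: mult_ac)
      then show ?thesis
        unfolding that by (simp add: mult_ac)
    qed
    have "real (Suc s choose Suc k) * real (Suc k) = real (Suc s) * real (s choose k)"
      using Suc_times_binomial[of k s] by (metis mult.commute of_nat_mult)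
    then have "(- e) * real (Suc s choose Suc k) * (real (Suc k) * z) = - real (Suc s) * (e * real (s choose k) * z)"
      for e z :: real
      by (rule *)
    moreover have "y + real (Suc k) * h = (y + h) + real k * h"
      by (simp add: algebra_simps)
    ultimately show "(-1) ^ Suc k * real (Suc s choose Suc k) * (real (Suc k) * (y + real (Suc k) * h) ^ \<nu>)
      = - real (Suc s) * ((-1) ^ k * real (s choose k) * ((y + h) + real k * h) ^ \<nu>)"
      by (simp only: power_Suc mult_minus1)
  qed
  also have "\<dots> = - real (Suc s) * (\<Sum>k\<le>s. (-1) ^ k * real (s choose k) * ((y + h) + real k * h) ^ \<nu>)"
    by (simp only: sum_distrib_left)
  also have "\<dots> = 0"
    using Suc.IH[OF s] by simp
  finally have 1: "(\<Sum>k\<le>r. (-1) ^ k * real (r choose k) * (real k * (y + real k * h) ^ \<nu>)) = 0" .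
  have split: "e * (y + d * h) ^ Suc \<nu> = y * (e * (y + d * h) ^ \<nu>) + h * (e * (d * (y + d * h) ^ \<nu>))"
    for e d :: real
  proof -
    have "e * (z * w) = y * (e * w) + h * (e * (d * w))" if "z = y + d * h" for z w
      unfolding that by (simp add: algebra_simps)
    then show ?thesis
      unfolding power_Suc by blast
  qed
  have "(\<Sum>k\<le>r. (-1) ^ k * real (r choose k) * (y + real k * h) ^ Suc \<nu>)
    = y * (\<Sum>k\<le>r. (-1) ^ k * real (r choose k) * (y + real k * h) ^ \<nu>)
      + h * (\<Sum>k\<le>r. (-1) ^ k * real (r choose k) * (real k * (y + real k * h) ^ \<nu>))"
    by (simp only: split sum_distrib_left sum.distrib)
  also have "\<dots> = 0"
    using 1 Suc.IH[of r y] Suc.prems by simp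
  finally show ?case .
qed

text \<open>Discrete comparison of a sum with the integral of \<open>x ^ q\<close>: the increment of
  \<open>x ^ Suc q\<close> from \<open>n\<close> to \<open>Suc n\<close> factors into
  \<open>Suc q\<close> products, each at most \<open>real (Suc n) ^ q\<close>.\<close>

lemma power_Suc_le_sum_powers: "real n ^ Suc q \<le> real (Suc q) * (\<Sum>k\<le>n. real k ^ q)"
proof (induction n)
  case (Suc n)
  have "real (Suc n) ^ Suc q - real n ^ Suc q
      = (\<Sum>p<Suc q. real (Suc n) ^ p * real n ^ (q - p))"
    by (subst power_diff_sumr2) (simp_all add: mult.commute)
  also have "\<dots> \<le> (\<Sum>p<Suc q. real (Suc n) ^ q)"
  proof (rule sum_mono)
    fix p assume "p \<in> {..<Suc q}"
    then have "real (Suc n) ^ q = real (Suc n) ^ p * real (Suc n) ^ (q - p)"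
      by (simp flip: power_add)
    then show "real (Suc n) ^ p * real n ^ (q - p) \<le> real (Suc n) ^ q"
      by (simp add: mult_left_mono power_mono)
  qed
  also have "\<dots> = real (Suc q) * real (Suc n) ^ q"
    by simp
  finally show ?case
    using Suc by (simp add: algebra_simps)
qed simp

section \<open>The energy of a spline with unit knot spacing\<close>

text \<open>The restriction of \<open>\<Sum>i. a i * relu_pow q (x - i)\<close> to \<open>m \<le> x \<le> m + 1\<close>, in the local
  coordinate \<open>t = x - m\<close>.\<close>
definition spline_piece :: "nat \<Rightarrow> (nat \<Rightarrow> real) \<Rightarrow> nat \<Rightarrow> real \<Rightarrow> real" where
  "spline_piece q a m t = (\<Sum>i\<le>m. a i * (real (m - i) + t) ^ q)"

text \<open>For positive \<open>q\<close> this is the squared L2 norm over \<open>{0..N}\<close> of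
  the spline with coefficients \<open>a\<close>. Going cell by cell makes every integrand a
  polynomial on \<open>{0..1}\<close>.\<close>

definition spline_energy :: "nat \<Rightarrow> nat \<Rightarrow> (nat \<Rightarrow> real) \<Rightarrow> real" where
  "spline_energy q N a = (\<Sum>m<N. integral {0..1} (\<lambda>t. (spline_piece q a m t)\<^sup>2))"

lemma continuous_on_spline_piece [continuous_intros]:
  "continuous_on S f \<Longrightarrow> continuous_on S (\<lambda>t. spline_piece q a m (f t))"
  unfolding spline_piece_def by (intro continuous_intros)

lemma integrable_spline_piece_square:
  "(\<lambda>t. (spline_piece q a m t)\<^sup>2) integrable_on {u..v}"
  by (intro integrable_continuous_real continuous_intros)

lemma integral_spline_piece_square_nonneg:
  "0 \<le> integral {u..v} (\<lambda>t. (spline_piece q a m t)\<^sup>2)"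
  by (intro integral_nonneg integrable_spline_piece_square) auto

lemma spline_energy_mono: "M \<le> N \<Longrightarrow> spline_energy q M a \<le> spline_energy q N a"
  unfolding spline_energy_def
  by (intro sum_mono2) (auto intro: integral_spline_piece_square_nonneg)

lemma spline_piece_cong:
  "(\<And>i. i \<le> m \<Longrightarrow> a i = b i) \<Longrightarrow> spline_piece q a m t = spline_piece q b m t"
  unfolding spline_piece_def by (intro sum.cong) auto

lemma spline_piece_scale: "spline_piece q (\<lambda>i. c * a i) m t = c * spline_piece q a m t"
  unfolding spline_piece_def by (simp add: sum_distrib_left mult.assoc)

lemma spline_energy_cong:
  "(\<And>i. i < N \<Longrightarrow> a i = b i) \<Longrightarrow> spline_energy q N a = spline_energy q N b"
  unfolding spline_energy_def
  by (intro sum.cong refl arg_cong[where f = "integral _"] ext) (auto cong: spline_piece_cong)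

lemma spline_energy_scale: "spline_energy q N (\<lambda>i. c * a i) = c\<^sup>2 * spline_energy q N a"
  unfolding spline_energy_def
  by (simp add: spline_piece_scale power_mult_distrib sum_distrib_left)

text \<open>Past a knot the spline continues the polynomial of the previous piece and only gains the
  term of the new knot.\<close>

lemma spline_piece_Suc:
  "spline_piece q a (Suc m) t = a (Suc m) * t ^ q + spline_piece q a m (1 + t)"
proof -
  have "(\<Sum>i\<le>m. a i * (real (Suc m - i) + t) ^ q) = spline_piece q a m (1 + t)"
    unfolding spline_piece_def by (intro sum.cong refl) (auto simp: of_nat_diff algebra_simps)
  then show ?thesis
    unfolding spline_piece_def[of q a "Suc m"] by simp
qed

text \<open>A piece is a polynomial of degree at most \<open>q\<close> in its local coordinate, so
  differences of higher order annihilate it.\<close>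

lemma spline_piece_finite_difference:
  assumes "q < r"
  shows "(\<Sum>k\<le>r. (-1) ^ k * real (r choose k) * spline_piece q a m (y - real k * h)) = 0"
proof -
  have "(\<Sum>k\<le>r. (-1) ^ k * real (r choose k) * spline_piece q a m (y - real k * h))
    = (\<Sum>k\<le>r. \<Sum>i\<le>m. a i * ((-1) ^ k * real (r choose k) * ((real (m - i) + y) + real k * (- h)) ^ q))"
    unfolding spline_piece_def sum_distrib_left
    by (intro sum.cong refl) (simp add: algebra_simps)
  also have "\<dots> = (\<Sum>i\<le>m. a i * (\<Sum>k\<le>r. (-1) ^ k * real (r choose k) * ((real (m - i) + y) + real k * (- h)) ^ q))"
    by (subst sum.swap) (simp only: sum_distrib_left)
  also have "\<dots> = 0"
    by (simp only: finite_difference_power_eq_0[OF assms] mult_zero_right sum.neutral_const)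
  finally show ?thesis .
qed

text \<open>Extrapolating the polynomial of the previous piece beyond its interval by a finite difference
  of order \<open>q + 1\<close> isolates the jump term \<open>a m * t ^ q\<close>.\<close>
lemma coeff_square_le_pieces:
  assumes t: "0 \<le> t" "t \<le> 1 / real (Suc q)"
  shows "(a (Suc m))\<^sup>2 * t ^ (2 * q) \<le> real (q + 2) *
    ((spline_piece q a (Suc m) t)\<^sup>2
      + (\<Sum>k\<in>{1..Suc q}. (real (Suc q choose k) * spline_piece q a m (1 + t - real k * (1 / real (Suc q))))\<^sup>2))"
proof -
  \<comment> \<open>With this step the points \<open>1 + t - k * h\<close> for \<open>k\<close> from
    1 to \<open>Suc q\<close> all stay in \<open>{0..1}\<close>; only the point for
    \<open>k = 0\<close> can leave the cell of the previous piece.\<close>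
  define h where "h = 1 / real (Suc q)"
  have sign: "((-1 :: real) ^ k)\<^sup>2 = 1" for k
    by (simp add: power2_eq_square flip: power_mult_distrib)
  \<comment> \<open>Exchanging the extrapolated value at \<open>k = 0\<close> for the new piece
    changes the vanishing sum by exactly \<open>a (Suc m) * t ^ q\<close>.\<close>
  define f where "f k = (if k = 0 then spline_piece q a (Suc m) t
      else (-1) ^ k * real (Suc q choose k) * spline_piece q a m (1 + t - real k * h))" for k
  have "(\<Sum>k\<le>Suc q. (-1) ^ k * real (Suc q choose k) * spline_piece q a m (1 + t - real k * h)) = 0"
    by (rule spline_piece_finite_difference) simp
  then have "spline_piece q a m (1 + t)
      + (\<Sum>k\<in>{1..Suc q}. (-1) ^ k * real (Suc q choose k) * spline_piece q a m (1 + t - real k * h)) = 0"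
    by (simp add: sum.atMost_shift atMost_atLeast0 sum.atLeast_Suc_atMost[of 0])
  moreover have "(\<Sum>k\<le>Suc q. f k) = spline_piece q a (Suc m) t
      + (\<Sum>k\<in>{1..Suc q}. (-1) ^ k * real (Suc q choose k) * spline_piece q a m (1 + t - real k * h))"
    unfolding atMost_atLeast0 f_def
    by (subst sum.atLeast_Suc_atMost) auto
  ultimately have "a (Suc m) * t ^ q = (\<Sum>k\<le>Suc q. f k)"
    by (simp add: spline_piece_Suc)
  then have "(a (Suc m))\<^sup>2 * t ^ (2 * q) = (\<Sum>k\<le>Suc q. f k)\<^sup>2"
    by (metis mult.commute power_mult power_mult_distrib)
  also have "\<dots> \<le> real (q + 2) * (\<Sum>k\<le>Suc q. (f k)\<^sup>2)"
    using sum_squared_le_sum_of_squares[of f "{..Suc q}"] by (simp add: add.commute mult.commute)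
  also have "(\<Sum>k\<le>Suc q. (f k)\<^sup>2) = (spline_piece q a (Suc m) t)\<^sup>2
      + (\<Sum>k\<in>{1..Suc q}. (real (Suc q choose k) * spline_piece q a m (1 + t - real k * h))\<^sup>2)"
    unfolding atMost_atLeast0 f_def
    by (subst sum.atLeast_Suc_atMost) (auto simp: power_mult_distrib sign)
  finally show ?thesis
    unfolding h_def .
qed

section \<open>Control of the coefficients by the energy\<close>

lemma has_integral_power_Icc_0: 
  fixes h :: real
  assumes "0 \<le> h"
  shows "((\<lambda>t. t ^ n) has_integral h ^ Suc n / real (Suc n)) {0..h}"
proof -
  have "((\<lambda>t. t ^ Suc n / real (Suc n)) has_real_derivative t ^ n) (at t within {0..h})" for t
    using DERIV_cdivide[OF DERIV_pow[of "Suc n" t "{0..h}"], of "real (Suc n)"] by simp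
  then have "((\<lambda>t. t ^ n) has_integral (h ^ Suc n / real (Suc n) - 0 ^ Suc n / real (Suc n))) {0..h}"
    using assms
    by (intro fundamental_theorem_of_calculus)
       (auto simp flip: has_real_derivative_iff_has_vector_derivative)
  then show ?thesis by simp
qed

lemma integral_shifted_piece_le:
  assumes "0 \<le> u" "0 \<le> h" "u + h \<le> 1"
  shows "integral {0..h} (\<lambda>t. (spline_piece q a m (u + t))\<^sup>2)
      \<le> integral {0..1} (\<lambda>t. (spline_piece q a m t)\<^sup>2)"
proof -
  have "integral {0..h} (\<lambda>t. (spline_piece q a m (u + t))\<^sup>2)
      = integral {0 + u..h + u} (\<lambda>t. (spline_piece q a m t)\<^sup>2)"
    by (subst integral_shift[symmetric]) (auto simp: o_def add.commute intro!: continuous_intros)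
  also have "\<dots> \<le> integral {0..1} (\<lambda>t. (spline_piece q a m t)\<^sup>2)"
    using assms by (intro integral_subset_le integrable_spline_piece_square) auto
  finally show ?thesis .
qed

text \<open>The pointwise bound is integrated over \<open>0 \<le> t \<le> 1 / Suc q\<close>, where
  all sample points run through subintervals of the unit cell. \<open>K\<close> collects the
  reciprocal of the integral of \<open>t ^ (2 * q)\<close>, the Cauchy-Schwarz factor
  \<open>q + 2\<close> and the squared binomial coefficients.\<close>

lemma coeff_square_le_integrals:
  fixes q :: nat
  defines "K \<equiv> real (2 * q + 1) * real (Suc q) ^ (2 * q + 1) * real (q + 2)
      * (1 + (\<Sum>k\<in>{1..Suc q}. (real (Suc q choose k))\<^sup>2))"
  shows "(a (Suc m))\<^sup>2 \<le> K * (integral {0..1} (\<lambda>t. (spline_piece q a (Suc m) t)\<^sup>2)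
      + integral {0..1} (\<lambda>t. (spline_piece q a m t)\<^sup>2))"
    and "(a 0)\<^sup>2 \<le> K * integral {0..1} (\<lambda>t. (spline_piece q a 0 t)\<^sup>2)"
proof -
  define h where "h = 1 / real (Suc q)"
  define J where "J n = integral {0..1} (\<lambda>t. (spline_piece q a n t)\<^sup>2)" for n
  define S where "S = (\<Sum>k\<in>{1..Suc q}. (real (Suc q choose k))\<^sup>2)"
  have h: "0 < h" "h \<le> 1" by (auto simp: h_def field_simps)
  have S: "0 \<le> S" unfolding S_def by (rule sum_nonneg) simp
  have J: "0 \<le> J n" for n unfolding J_def by (rule integral_spline_piece_square_nonneg)
  have c1: "1 \<le> real (Suc q) ^ (2 * q + 1)" by (rule one_le_power) simp
  have K: "K = real (2 * q + 1) * real (Suc q) ^ (2 * q + 1) * (real (q + 2) * (1 + S))"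
    by (simp add: K_def S_def)
  have "(a (Suc m))\<^sup>2 * (h ^ Suc (2 * q) / real (Suc (2 * q)))
      = integral {0..h} (\<lambda>t. (a (Suc m))\<^sup>2 * t ^ (2 * q))"
    using has_integral_power_Icc_0[of h "2 * q"] h by (simp add: integral_unique)
  also have "\<dots> \<le> integral {0..h} (\<lambda>t. real (q + 2) * ((spline_piece q a (Suc m) t)\<^sup>2
      + (\<Sum>k\<in>{1..Suc q}. (real (Suc q choose k) * spline_piece q a m (1 + t - real k * h))\<^sup>2)))"
    unfolding h_def
    by (intro integral_le integrable_continuous_real continuous_intros coeff_square_le_pieces) auto
  also have "\<dots> = real (q + 2) * (integral {0..h} (\<lambda>t. (spline_piece q a (Suc m) t)\<^sup>2)
      + (\<Sum>k\<in>{1..Suc q}. (real (Suc q choose k))\<^sup>2 * integral {0..h} (\<lambda>t. (spline_piece q a m ((1 - real k * h) + t))\<^sup>2)))"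
    apply (subst integral_mult_right)
    apply (subst Henstock_Kurzweil_Integration.integral_add)
      apply (intro integrable_continuous_real continuous_intros; fail)
     apply (intro integrable_continuous_real continuous_intros; fail)
    apply (subst Henstock_Kurzweil_Integration.integral_sum)
      apply simp
     apply (intro integrable_continuous_real continuous_intros; fail)
    apply (simp add: power_mult_distrib algebra_simps)
    done
  also have "\<dots> \<le> real (q + 2) * (J (Suc m) + (\<Sum>k\<in>{1..Suc q}. (real (Suc q choose k))\<^sup>2 * J m))"
  proof (intro mult_left_mono add_mono sum_mono)
    show "integral {0..h} (\<lambda>t. (spline_piece q a (Suc m) t)\<^sup>2) \<le> J (Suc m)"
      using h integral_shifted_piece_le[of 0 h] by (simp add: J_def)
    fix k assume "k \<in> {1..Suc q}"
    then show "integral {0..h} (\<lambda>t. (spline_piece q a m ((1 - real k * h) + t))\<^sup>2) \<le> J m"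
      unfolding J_def h_def by (intro integral_shifted_piece_le) (auto simp: field_simps)
  qed auto
  also have "\<dots> = real (q + 2) * (J (Suc m) + S * J m)"
    by (simp only: S_def sum_distrib_right)
  also have "\<dots> \<le> real (q + 2) * ((1 + S) * (J (Suc m) + J m))"
    using S J by (intro mult_left_mono) (auto simp: algebra_simps)
  finally have "(a (Suc m))\<^sup>2 * (h ^ Suc (2 * q) / real (Suc (2 * q))) \<le> real (q + 2) * ((1 + S) * (J (Suc m) + J m))" .
  moreover have "(a (Suc m))\<^sup>2 * (h ^ Suc (2 * q) / real (Suc (2 * q)))
      = (a (Suc m))\<^sup>2 / (real (2 * q + 1) * real (Suc q) ^ (2 * q + 1))"
    by (simp add: h_def power_divide)
  ultimately have "(a (Suc m))\<^sup>2 / (real (2 * q + 1) * real (Suc q) ^ (2 * q + 1)) \<le> real (q + 2) * ((1 + S) * (J (Suc m) + J m))"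
    by (simp only:)
  then show "(a (Suc m))\<^sup>2 \<le> K * (integral {0..1} (\<lambda>t. (spline_piece q a (Suc m) t)\<^sup>2)
      + integral {0..1} (\<lambda>t. (spline_piece q a m t)\<^sup>2))"
    unfolding K J_def[symmetric]
    by (subst (asm) pos_divide_le_eq) (auto simp: algebra_simps simp del: of_nat_Suc)
  \<comment> \<open>The first cell has no predecessor; its piece is the monomial
    \<open>a 0 * t ^ q\<close>, whose energy is explicit.\<close>
  have "J 0 = integral {0..1} (\<lambda>t. (a 0)\<^sup>2 * t ^ (2 * q))"
    unfolding J_def spline_piece_def by (simp add: power_mult_distrib flip: power_mult) (simp add: mult.commute)
  also have "\<dots> = (a 0)\<^sup>2 * (1 ^ Suc (2 * q) / real (Suc (2 * q)))"
    using has_integral_power_Icc_0[of 1 "2 * q"] by (subst integral_mult_right) (simp add: integral_unique)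
  finally have "(a 0)\<^sup>2 = real (2 * q + 1) * J 0"
    by (simp add: field_simps)
  also have "\<dots> \<le> real (2 * q + 1) * (real (Suc q) ^ (2 * q + 1) * (real (q + 2) * (1 + S))) * J 0"
  proof -
    have "1 \<le> real (q + 2) * (1 + S)"
      using S mult_mono[of 1 "real (q + 2)" 1 "1 + S"] by simp
    then have "1 \<le> real (Suc q) ^ (2 * q + 1) * (real (q + 2) * (1 + S))"
      using c1 mult_mono[of 1 "real (Suc q) ^ (2 * q + 1)" 1 "real (q + 2) * (1 + S)"] by simp
    then show ?thesis
      using J[of 0] by (intro mult_right_mono) (auto intro: mult_left_mono[of 1, simplified])
  qed
  finally show "(a 0)\<^sup>2 \<le> K * integral {0..1} (\<lambda>t. (spline_piece q a 0 t)\<^sup>2)"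
    unfolding K J_def by (simp add: mult.assoc)
qed

text \<open>Summing the bounds for the single coefficients uses the energy of each cell at most
  twice. The constant depends on \<open>q\<close> alone, which later gives a lower bound for all
  eigenvalues at once.\<close>

lemma sum_squares_le_spline_energy:
  "\<exists>C>0. \<forall>N a. (\<Sum>i<N. (a i)\<^sup>2) \<le> C * spline_energy q N a"
proof -
  define K where "K = real (2 * q + 1) * real (Suc q) ^ (2 * q + 1) * real (q + 2)
      * (1 + (\<Sum>k\<in>{1..Suc q}. (real (Suc q choose k))\<^sup>2))"
  have "0 \<le> (\<Sum>k\<in>{1..Suc q}. (real (Suc q choose k))\<^sup>2)"
    by (rule sum_nonneg) simp
  then have K: "0 < K"
    unfolding K_def by (intro mult_pos_pos) auto
  have "(\<Sum>i<N. (a i)\<^sup>2) \<le> 2 * K * spline_energy q N a" for N a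
  proof -
    define J where "J n = integral {0..1} (\<lambda>t. (spline_piece q a n t)\<^sup>2)" for n
    have J: "0 \<le> J n" for n unfolding J_def by (rule integral_spline_piece_square_nonneg)
    \<comment> \<open>The extra \<open>K * J n\<close> records that the last cell has been used only
      once; the second copy pays for the next coefficient.\<close>
    have "(\<Sum>i<Suc n. (a i)\<^sup>2) + K * J n \<le> 2 * K * (\<Sum>i<Suc n. J i)" for n
    proof (induction n)
      case 0
      then show ?case
        using coeff_square_le_integrals(2)[where q = q and a = a, folded K_def J_def] by simp
    next
      case (Suc n)
      then show ?case
        using coeff_square_le_integrals(1)[where q = q and a = a and m = n, folded K_def J_def]
        by (simp add: algebra_simps)
    qed
    moreover have "0 \<le> K * J n" for n using K J by simp
    ultimately have "(\<Sum>i<Suc n. (a i)\<^sup>2) \<le> 2 * K * (\<Sum>i<Suc n. J i)" for n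
      by (smt (verit))
    then show ?thesis
      unfolding spline_energy_def J_def[symmetric] by (cases N) auto
  qed
  then show ?thesis
    using K by (intro exI[of _ "2 * K"]) auto
qed

section \<open>Splines decoupling into blocks\<close>

lemma sum_nat_blocks:
  fixes f :: "nat \<Rightarrow> 'a::comm_monoid_add"
  shows "sum f {..<B * L} = (\<Sum>b<B. \<Sum>i<L. f (b * L + i))"
proof -
  have "sum f {b * L..<b * L + L} = (\<Sum>i<L. f (b * L + i))" for b
    by (rule sum.reindex_bij_witness[of _ "\<lambda>i. b * L + i" "\<lambda>i. i - b * L"]) auto
  then show ?thesis
    by (simp flip: sum.nat_group)
qed

text \<open>To the right of a block its knots contribute a polynomial in \<open>y\<close>, which the
  assumption makes identically zero; hence a cell only feels the coefficients of its own
  block.\<close>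

lemma spline_piece_block:
  assumes "\<And>b' y. b' < b \<Longrightarrow> (\<Sum>i<L. a (b' * L + i) * (y - real i) ^ q) = 0"
  shows "spline_piece q a (b * L + s) t = spline_piece q (\<lambda>i. a (b * L + i)) s t"
proof -
  have "{..b * L + s} = {..<b * L} \<union> {b * L..b * L + s}"
    by auto
  then have "spline_piece q a (b * L + s) t
      = (\<Sum>i<b * L. a i * (real (b * L + s - i) + t) ^ q)
        + (\<Sum>i\<in>{b * L..b * L + s}. a i * (real (b * L + s - i) + t) ^ q)"
    unfolding spline_piece_def by (simp only:) (rule sum.union_disjoint, auto)
  also have "(\<Sum>i<b * L. a i * (real (b * L + s - i) + t) ^ q)
      = (\<Sum>b'<b. \<Sum>i<L. a (b' * L + i) * ((real (b * L + s) + t - real (b' * L)) - real i) ^ q)"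
    unfolding sum_nat_blocks
  proof (intro sum.cong refl)
    fix b' i assume "b' \<in> {..<b}" "i \<in> {..<L}"
    \<comment> \<open>Knots of earlier blocks lie to the left of the cell, so the subtraction of
      naturals is not truncated.\<close>
    then have "b' * L + i \<le> Suc b' * L" "Suc b' * L \<le> b * L"
      by (auto intro: mult_le_mono1 simp del: mult_Suc) simp
    then have "b' * L + i \<le> b * L + s"
      by linarith
    then show "a (b' * L + i) * (real (b * L + s - (b' * L + i)) + t) ^ q
      = a (b' * L + i) * ((real (b * L + s) + t - real (b' * L)) - real i) ^ q"
      by (simp add: of_nat_diff algebra_simps)
  qed
  also have "\<dots> = 0"
    using assms by simp
  also have "(\<Sum>i\<in>{b * L..b * L + s}. a i * (real (b * L + s - i) + t) ^ q)
      = spline_piece q (\<lambda>i. a (b * L + i)) s t"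
    unfolding spline_piece_def atMost_atLeast0
    by (subst sum.atLeastAtMost_shift_0) auto
  finally show ?thesis
    by simp
qed

text \<open>\<open>Suc b < B\<close> selects the blocks with another block to their right, which are
  those whose tails could interfere.\<close>

lemma spline_energy_blocks:
  assumes "\<And>b y. Suc b < B \<Longrightarrow> (\<Sum>i<L. a (b * L + i) * (y - real i) ^ q) = 0"
  shows "spline_energy q (B * L) a = (\<Sum>b<B. spline_energy q L (\<lambda>i. a (b * L + i)))"
  unfolding spline_energy_def sum_nat_blocks
proof (intro sum.cong refl)
  fix b s assume "b \<in> {..<B}"
  then have "spline_piece q a (b * L + s) t = spline_piece q (\<lambda>i. a (b * L + i)) s t" for t
    by (intro spline_piece_block assms) auto
  then show "integral {0..1} (\<lambda>t. (spline_piece q a (b * L + s) t)\<^sup>2)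
      = integral {0..1} (\<lambda>t. (spline_piece q (\<lambda>i. a (b * L + i)) s t)\<^sup>2)"
    by simp
qed

text \<open>Cauchy-Schwarz at each point: at most \<open>L\<close> powers, each at most
  \<open>L ^ q\<close>, give the factor \<open>L ^ (2 * q + 1)\<close>, and the \<open>L\<close>
  cells give one more.\<close>

lemma spline_energy_le: "spline_energy q L a \<le> real L ^ (2 * q + 2) * (\<Sum>i<L. (a i)\<^sup>2)"
proof -
  have "integral {0..1} (\<lambda>t. (spline_piece q a m t)\<^sup>2)
      \<le> real L ^ (2 * q + 1) * (\<Sum>i<L. (a i)\<^sup>2)" if m: "m < L" for m
  proof -
    have "(spline_piece q a m t)\<^sup>2 \<le> real L ^ (2 * q + 1) * (\<Sum>i<L. (a i)\<^sup>2)"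
      if t: "0 \<le> t" "t \<le> 1" for t
    proof -
      have "(spline_piece q a m t)\<^sup>2 \<le> (\<Sum>i\<le>m. (a i)\<^sup>2) * (\<Sum>i\<le>m. ((real (m - i) + t) ^ q)\<^sup>2)"
        unfolding spline_piece_def by (rule Cauchy_Schwarz_ineq_sum)
      also have "\<dots> \<le> (\<Sum>i<L. (a i)\<^sup>2) * (\<Sum>i<L. real L ^ (2 * q))"
      proof (intro mult_mono)
        show "(\<Sum>i\<le>m. (a i)\<^sup>2) \<le> (\<Sum>i<L. (a i)\<^sup>2)"
          using m by (intro sum_mono2) auto
        have "(\<Sum>i\<le>m. ((real (m - i) + t) ^ q)\<^sup>2) \<le> (\<Sum>i\<le>m. real L ^ (2 * q))"
        proof (rule sum_mono)
          fix i
          have "real (m - i) + t \<le> real m + 1"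
            using t by (intro add_mono) auto
          also have "\<dots> \<le> real L"
            using m by linarith
          finally have "(real (m - i) + t) ^ (2 * q) \<le> real L ^ (2 * q)"
            using t by (intro power_mono) auto
          then show "((real (m - i) + t) ^ q)\<^sup>2 \<le> real L ^ (2 * q)"
            by (simp add: mult.commute flip: power_mult)
        qed
        also have "\<dots> \<le> (\<Sum>i<L. real L ^ (2 * q))"
          using m by (intro sum_mono2) auto
        finally show "(\<Sum>i\<le>m. ((real (m - i) + t) ^ q)\<^sup>2) \<le> (\<Sum>i<L. real L ^ (2 * q))" .
      qed (auto intro: sum_nonneg)
      also have "\<dots> = real L ^ (2 * q + 1) * (\<Sum>i<L. (a i)\<^sup>2)"
        by simp
      finally show ?thesis .
    qed
    then have "integral {0..1} (\<lambda>t. (spline_piece q a m t)\<^sup>2)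
        \<le> integral {0..1} (\<lambda>t::real. real L ^ (2 * q + 1) * (\<Sum>i<L. (a i)\<^sup>2))"
      by (intro integral_le integrable_spline_piece_square integrable_const_ivl) auto
    then show ?thesis
      by simp
  qed
  then have "spline_energy q L a \<le> (\<Sum>m<L. real L ^ (2 * q + 1) * (\<Sum>i<L. (a i)\<^sup>2))"
    unfolding spline_energy_def by (intro sum_mono) auto
  also have "\<dots> = real L ^ (2 * q + 2) * (\<Sum>i<L. (a i)\<^sup>2)"
    by simp
  finally show ?thesis .
qed

text \<open>The binomial expansion in powers of \<open>i\<close> reduces an identity for all
  \<open>y\<close> to \<open>q + 1\<close> linear conditions on the coefficients.\<close>

lemma moments_eq_0_imp_power_sum_eq_0:
  fixes c :: "nat \<Rightarrow> real"
  assumes "\<And>\<nu>. \<nu> \<le> q \<Longrightarrow> (\<Sum>i<L. c i * real i ^ \<nu>) = 0"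
  shows "(\<Sum>i<L. c i * (y - real i) ^ q) = 0"
proof -
  have "(y - real i) ^ q = (\<Sum>\<nu>\<le>q. real (q choose \<nu>) * (-1) ^ \<nu> * y ^ (q - \<nu>) * real i ^ \<nu>)" for i
  proof -
    have "(y - real i) ^ q = (- real i + y) ^ q"
      by simp
    also have "\<dots> = (\<Sum>\<nu>\<le>q. of_nat (q choose \<nu>) * (- real i) ^ \<nu> * y ^ (q - \<nu>))"
      by (rule binomial_ring)
    also have "\<dots> = (\<Sum>\<nu>\<le>q. real (q choose \<nu>) * (-1) ^ \<nu> * y ^ (q - \<nu>) * real i ^ \<nu>)"
      by (intro sum.cong refl, subst power_minus) simp
    finally show ?thesis .
  qed
  then have "(\<Sum>i<L. c i * (y - real i) ^ q)
      = (\<Sum>\<nu>\<le>q. \<Sum>i<L. real (q choose \<nu>) * (-1) ^ \<nu> * y ^ (q - \<nu>) * (c i * real i ^ \<nu>))"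
    by (subst sum.swap) (simp add: sum_distrib_left mult_ac)
  also have "\<dots> = 0"
    using assms by (simp flip: sum_distrib_left)
  finally show ?thesis .
qed

text \<open>Decoupling replaces the full length by the block length \<open>L\<close> in the power,
  at the price of \<open>(q + 1) * (B - 1)\<close> linear conditions.\<close>

lemma spline_energy_le_of_block_moments:
  assumes "\<And>b \<nu>. Suc b < B \<Longrightarrow> \<nu> \<le> q \<Longrightarrow> (\<Sum>i<L. a (b * L + i) * real i ^ \<nu>) = 0"
  shows "spline_energy q (B * L) a \<le> real L ^ (2 * q + 2) * (\<Sum>i<B * L. (a i)\<^sup>2)"
proof -
  have "spline_energy q (B * L) a = (\<Sum>b<B. spline_energy q L (\<lambda>i. a (b * L + i)))"
    using assms by (intro spline_energy_blocks moments_eq_0_imp_power_sum_eq_0) auto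
  also have "\<dots> \<le> (\<Sum>b<B. real L ^ (2 * q + 2) * (\<Sum>i<L. (a (b * L + i))\<^sup>2))"
    by (intro sum_mono spline_energy_le)
  also have "\<dots> = real L ^ (2 * q + 2) * (\<Sum>i<B * L. (a i)\<^sup>2)"
    unfolding sum_nat_blocks sum_distrib_left ..
  finally show ?thesis .
qed

text \<open>The coefficients of \<open>(1 - z ^ l) ^ (q + 1) * (1 + z + \<dots> + z ^ (l - 1))\<close>. Their spline is,
  up to scaling, a smoothed B-spline supported on \<open>{0..(q + 2) * l}\<close>.\<close>
definition bump :: "nat \<Rightarrow> nat \<Rightarrow> nat \<Rightarrow> real" where
  "bump q l i = (-1) ^ (i div l) * real (Suc q choose (i div l))"

section \<open>Energy and norm of superposed bumps\<close>

lemma bump_block: "i < l \<Longrightarrow> bump q l (k * l + i) = (-1) ^ k * real (Suc q choose k)"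
  by (simp add: bump_def)

text \<open>For each fixed offset inside the runs of length \<open>l\<close>, the sum over the runs
  is a difference of order \<open>q + 1\<close> with step \<open>- l\<close> of a power of degree
  \<open>q\<close>.\<close>

lemma bump_power_sum_eq_0: "(\<Sum>i<(q + 2) * l. bump q l i * (y - real i) ^ q) = 0"
proof -
  have "(\<Sum>i<(q + 2) * l. bump q l i * (y - real i) ^ q)
      = (\<Sum>k<q + 2. \<Sum>i<l. (-1) ^ k * real (Suc q choose k) * ((y - real i) + real k * (- real l)) ^ q)"
    unfolding sum_nat_blocks by (intro sum.cong refl) (simp add: bump_block, simp add: algebra_simps)
  also have "\<dots> = (\<Sum>i<l. \<Sum>k\<le>Suc q. (-1) ^ k * real (Suc q choose k) * ((y - real i) + real k * (- real l)) ^ q)"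
    by (subst sum.swap) (simp add: lessThan_Suc_atMost)
  also have "\<dots> = 0"
    by (simp only: finite_difference_power_eq_0[OF lessI] sum.neutral_const)
  finally show ?thesis .
qed

lemma bump_square_sum:
  "(\<Sum>i<(q + 2) * l. (bump q l i)\<^sup>2) = real l * (\<Sum>k\<le>Suc q. (real (Suc q choose k))\<^sup>2)"
proof -
  have "((-1 :: real) ^ k)\<^sup>2 = 1" for k
    by (simp add: power2_eq_square flip: power_mult_distrib)
  then have "(\<Sum>i<(q + 2) * l. (bump q l i)\<^sup>2) = (\<Sum>k<q + 2. \<Sum>i<l. (real (Suc q choose k))\<^sup>2)"
    unfolding sum_nat_blocks by (intro sum.cong refl) (auto simp: bump_block power_mult_distrib)
  then show ?thesis
    by (simp add: lessThan_Suc_atMost sum_distrib_left distrib_left)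
qed

text \<open>On the first \<open>l\<close> cells all coefficients involved are 1, so the spline is a
  sum of nonnegative powers of order \<open>m ^ (q + 1)\<close>; the other cells are dropped. As the
  squared norm of the bump is proportional to \<open>l\<close>, its Rayleigh quotient is at least of
  order \<open>l ^ (2 * q + 2)\<close>.\<close>

lemma spline_energy_bump_ge:
  assumes "2 \<le> l"
  shows "real l ^ (2 * q + 3) \<le> 2 ^ (2 * q + 3) * real (2 * q + 3) * (real (q + 1))\<^sup>2
    * spline_energy q ((q + 2) * l) (bump q l)"
proof -
  have piece: "(real m ^ Suc q)\<^sup>2 \<le> (real (q + 1))\<^sup>2 * integral {0..1} (\<lambda>t. (spline_piece q (bump q l) m t)\<^sup>2)"
    if m: "m < l" for m
  proof -
    have "(real m ^ Suc q / real (q + 1))\<^sup>2 \<le> (spline_piece q (bump q l) m t)\<^sup>2" if t: "0 \<le> t" for t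
    proof -
      have "real m ^ Suc q / real (q + 1) \<le> (\<Sum>i\<le>m. real i ^ q)"
        using power_Suc_le_sum_powers[of m q] by (simp add: field_simps)
      also have "\<dots> = (\<Sum>i\<le>m. real (m - i) ^ q)"
        by (rule sum.reindex_bij_witness[of _ "\<lambda>i. m - i" "\<lambda>i. m - i"]) auto
      also have "\<dots> \<le> (\<Sum>i\<le>m. (real (m - i) + t) ^ q)"
        using t by (intro sum_mono power_mono) auto
      also have "\<dots> = spline_piece q (bump q l) m t"
        unfolding spline_piece_def using m by (intro sum.cong) (auto simp: bump_def)
      finally show ?thesis
        by (intro power_mono) auto
    qed
    then have "integral {0..1} (\<lambda>t::real. (real m ^ Suc q / real (q + 1))\<^sup>2)
        \<le> integral {0..1} (\<lambda>t. (spline_piece q (bump q l) m t)\<^sup>2)"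
      by (intro integral_le integrable_spline_piece_square integrable_const_ivl) auto
    then show ?thesis
      by (simp add: power_divide field_simps)
  qed
  \<comment> \<open>The cells run only up to \<open>l - 1\<close>;
    \<open>l \<le> 2 * (l - 1)\<close> absorbs the shift.\<close>
  have "real l ^ (2 * q + 3) \<le> (2 * real (l - 1)) ^ (2 * q + 3)"
    using assms by (intro power_mono) auto
  also have "\<dots> = 2 ^ (2 * q + 3) * real (l - 1) ^ Suc (2 * q + 2)"
    by (simp add: power_mult_distrib eval_nat_numeral)
  also have "\<dots> \<le> 2 ^ (2 * q + 3) * (real (Suc (2 * q + 2)) * (\<Sum>m\<le>l - 1. real m ^ (2 * q + 2)))"
    by (intro mult_left_mono power_Suc_le_sum_powers) auto
  also have "(\<Sum>m\<le>l - 1. real m ^ (2 * q + 2)) = (\<Sum>m<l. (real m ^ Suc q)\<^sup>2)"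
  proof (rule sum.cong)
    show "{..l - 1} = {..<l}" using assms by auto
  next
    fix m
    have "2 * q + 2 = Suc q * 2" by simp
    then show "real m ^ (2 * q + 2) = (real m ^ Suc q)\<^sup>2" by (metis power_mult)
  qed
  also have "\<dots> \<le> (\<Sum>m<l. (real (q + 1))\<^sup>2 * integral {0..1} (\<lambda>t. (spline_piece q (bump q l) m t)\<^sup>2))"
    using piece by (intro sum_mono) auto
  also have "\<dots> = (real (q + 1))\<^sup>2 * spline_energy q l (bump q l)"
    unfolding spline_energy_def by (simp add: sum_distrib_left)
  also have "\<dots> \<le> (real (q + 1))\<^sup>2 * spline_energy q ((q + 2) * l) (bump q l)"
    by (intro mult_left_mono spline_energy_mono) auto
  finally show ?thesis
    by (simp add: mult_ac add_ac)
qed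

text \<open>Each bump annihilates the powers to its right, so energy and squared norm are both
  additive over the blocks. Cells beyond the \<open>B\<close> blocks can only add energy, hence an
  inequality in the first claim.\<close>

lemma spline_energy_bump_superposition:
  fixes x :: "nat \<Rightarrow> real"
  assumes l: "0 < l" and x: "\<And>b. B \<le> b \<Longrightarrow> x b = 0" and N: "B * ((q + 2) * l) \<le> N"
  defines "a \<equiv> \<lambda>i. x (i div ((q + 2) * l)) * bump q l (i mod ((q + 2) * l))"
  shows "(\<Sum>b<B. (x b)\<^sup>2) * spline_energy q ((q + 2) * l) (bump q l) \<le> spline_energy q N a" (is ?energy)
    and "(\<Sum>i<N. (a i)\<^sup>2) = (\<Sum>b<B. (x b)\<^sup>2) * (\<Sum>i<(q + 2) * l. (bump q l i)\<^sup>2)" (is ?norm)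
proof -
  define L where "L = (q + 2) * l"
  have a: "a (b * L + i) = x b * bump q l i" if "i < L" for b i
    using that unfolding a_def L_def[symmetric] by simp
  have "spline_energy q (B * L) a = (\<Sum>b<B. spline_energy q L (\<lambda>i. a (b * L + i)))"
  proof (rule spline_energy_blocks)
    fix b y
    have "(\<Sum>i<L. a (b * L + i) * (y - real i) ^ q) = x b * (\<Sum>i<L. bump q l i * (y - real i) ^ q)"
      unfolding sum_distrib_left by (intro sum.cong) (auto simp: a)
    then show "(\<Sum>i<L. a (b * L + i) * (y - real i) ^ q) = 0"
      unfolding L_def bump_power_sum_eq_0 by simp
  qed
  also have "\<dots> = (\<Sum>b<B. spline_energy q L (\<lambda>i. x b * bump q l i))"
    by (intro sum.cong refl spline_energy_cong) (auto simp: a)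
  also have "\<dots> = (\<Sum>b<B. (x b)\<^sup>2) * spline_energy q L (bump q l)"
    by (simp add: spline_energy_scale sum_distrib_right)
  finally show ?energy
    using spline_energy_mono[OF N, of q a] by (simp add: L_def)
  have "a i = 0" if "i \<in> {..<N} - {..<B * L}" for i
  proof -
    have "B \<le> i div L"
      using that l by (auto simp: less_eq_div_iff_mult_less_eq L_def)
    then show ?thesis
      using x by (simp add: a_def L_def)
  qed
  then have "(\<Sum>i<N. (a i)\<^sup>2) = (\<Sum>i<B * L. (a i)\<^sup>2)"
    using N by (intro sum.mono_neutral_right) (auto simp: L_def)
  also have "\<dots> = (\<Sum>b<B. \<Sum>i<L. (x b * bump q l i)\<^sup>2)"
    unfolding sum_nat_blocks by (intro sum.cong refl) (auto simp: a)
  also have "\<dots> = (\<Sum>b<B. (x b)\<^sup>2) * (\<Sum>i<L. (bump q l i)\<^sup>2)"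
    by (simp add: power_mult_distrib sum_product)
  finally show ?norm
    by (simp add: L_def)
qed

section \<open>Spectral theorem for real symmetric matrices\<close>

text \<open>The Hermitian form \<open>t\<close> of an eigenvector is \<open>z\<close> times its
  squared norm, and by symmetry it equals its own conjugate.\<close>

lemma symmetric_complex_eigenvalue_real:
  fixes A :: "real mat"
  assumes A: "A \<in> carrier_mat n n" and sym: "\<And>i j. i < n \<Longrightarrow> j < n \<Longrightarrow> A $$ (i, j) = A $$ (j, i)"
    and ev: "eigenvalue (map_mat complex_of_real A) z"
  shows "z \<in> \<real>"
proof -
  let ?A = "map_mat complex_of_real A"
  obtain v where v: "v \<in> carrier_vec n" "v \<noteq> 0\<^sub>v n" and eq: "?A *\<^sub>v v = z \<cdot>\<^sub>v v"
    using ev A unfolding eigenvalue_def eigenvector_def by auto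
  have comp: "(\<Sum>j<n. complex_of_real (A $$ (i, j)) * v $ j) = z * v $ i" if "i < n" for i
  proof -
    have "(?A *\<^sub>v v) $ i = (\<Sum>j<n. complex_of_real (A $$ (i, j)) * v $ j)"
      using that A v(1) by (auto simp: scalar_prod_def lessThan_atLeast0 intro!: sum.cong)
    then show ?thesis
      using that v(1) by (simp add: eq)
  qed
  define s where "s = (\<Sum>i<n. (cmod (v $ i))\<^sup>2)"
  define t where "t = (\<Sum>i<n. \<Sum>j<n. cnj (v $ i) * complex_of_real (A $$ (i, j)) * v $ j)"
  have "t = (\<Sum>i<n. cnj (v $ i) * (z * v $ i))"
    unfolding t_def by (intro sum.cong refl) (simp add: sum_distrib_left mult.assoc flip: comp)
  also have "\<dots> = z * of_real s"
    by (simp add: s_def sum_distrib_left complex_norm_square mult_ac del: of_real_power)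
  finally have t: "t = z * of_real s" .
  have "cnj t = (\<Sum>i<n. \<Sum>j<n. cnj (v $ j) * complex_of_real (A $$ (i, j)) * v $ i)"
    by (simp add: t_def mult_ac)
  also have "\<dots> = (\<Sum>j<n. \<Sum>i<n. cnj (v $ j) * complex_of_real (A $$ (i, j)) * v $ i)"
    by (rule sum.swap)
  also have "\<dots> = t"
    unfolding t_def using sym by (intro sum.cong refl) auto
  finally have "cnj z * of_real s = z * of_real s"
    by (simp add: t)
  moreover have "s \<noteq> 0"
  proof
    assume "s = 0"
    then have "\<forall>i<n. v $ i = 0"
      unfolding s_def by (subst (asm) sum_nonneg_eq_0_iff) auto
    then show False
      using v by (auto intro: eq_vecI)
  qed
  ultimately have "cnj z = z"
    by simp
  then show ?thesis
    by (simp add: Reals_cnj_iff)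
qed

section \<open>Sorted real factorisation of the characteristic polynomial\<close>

lemma map_poly_complex_of_real_mult:
  "map_poly complex_of_real (p * q) = map_poly complex_of_real p * map_poly complex_of_real q"
  by (intro poly_eqI) (simp add: coeff_mult coeff_map_poly)

text \<open>The polynomial splits over the complex numbers; all roots are real, so the factorisation
  is pulled back along the injective embedding of the reals.\<close>

lemma char_poly_symmetric_splits:
  fixes A :: "real mat"
  assumes A: "A \<in> carrier_mat n n" and sym: "\<And>i j. i < n \<Longrightarrow> j < n \<Longrightarrow> A $$ (i, j) = A $$ (j, i)"
  shows "\<exists>es. sorted_wrt (\<ge>) es \<and> char_poly A = (\<Prod>a\<leftarrow>es. [:- a, 1:])"
proof -
  let ?A = "map_mat complex_of_real A"
  have cA: "?A \<in> carrier_mat n n" using A by simp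
  obtain as where as: "char_poly ?A = (\<Prod>a\<leftarrow>as. [:- a, 1:])"
    using char_poly_factorized[OF cA] by blast
  have real: "complex_of_real (Re a) = a" if "a \<in> set as" for a
  proof -
    have "poly (char_poly ?A) a = 0"
      unfolding as poly_prod_list using that by (auto simp: prod_list_zero_iff)
    then have "eigenvalue ?A a"
      using eigenvalue_root_char_poly[OF cA] by simp
    then show ?thesis
      using symmetric_complex_eigenvalue_real[OF A sym] by simp
  qed
  have "map_poly complex_of_real (char_poly A) = (\<Prod>a\<leftarrow>as. [:- a, 1:])"
    by (simp add: of_real_hom.char_poly_hom[OF A] flip: as)
  also have "\<dots> = (\<Prod>a\<leftarrow>as. map_poly complex_of_real [:- Re a, 1:])"
    using real by (intro arg_cong[of _ _ prod_list] map_cong refl) auto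
  also have "\<dots> = map_poly complex_of_real (\<Prod>a\<leftarrow>as. [:- Re a, 1:])"
    by (induction as) (simp_all add: map_poly_complex_of_real_mult del: mult_pCons_left)
  finally have "char_poly A = (\<Prod>a\<leftarrow>as. [:- Re a, 1:])"
    by (simp add: poly_eq_iff coeff_map_poly)
  also have "\<dots> = prod_list (map (\<lambda>a. [:- a, 1:]) (map Re as))"
    by (simp add: o_def)
  \<comment> \<open>The product depends only on the multiset of its factors, so the roots may be
    sorted.\<close>
  also have "\<dots> = prod_list (map (\<lambda>a. [:- a, 1:]) (rev (sort (map Re as))))"
    by (rule arg_cong[of "mset _" "mset _" prod_mset, unfolded prod_mset_prod_list])
       (simp add: multiset.map_comp)
  finally show ?thesis
    by (intro exI[of _ "rev (sort (map Re as))"]) (simp add: sorted_wrt_rev)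
qed

text \<open>The head of each list is the largest root of the common polynomial; the heads agree and
  their linear factor cancels. This supplies the uniqueness behind the definite description in
  \<open>eigvals_desc\<close>.\<close>

lemma sorted_linear_factors_unique:
  fixes as bs :: "real list"
  assumes "sorted_wrt (\<ge>) as" "sorted_wrt (\<ge>) bs"
    and "(\<Prod>a\<leftarrow>as. [:- a, 1:]) = (\<Prod>b\<leftarrow>bs. [:- b, 1:])"
  shows "as = bs"
  using assms
proof (induction as arbitrary: bs)
  case Nil
  then show ?case
    using degree_linear_factors[of uminus bs] by simp
next
  case (Cons a as)
  show ?case
  proof (cases bs)
    case Nil
    then show ?thesis
      using Cons.prems degree_linear_factors[of uminus "a # as"] by simp
  next
    case (Cons b bs')
    have roots: "poly (\<Prod>a\<leftarrow>xs. [:- a, 1:]) x = 0 \<longleftrightarrow> x \<in> set xs" for xs and x :: real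
      by (induction xs) auto
    have same: "x \<in> set (a # as) \<longleftrightarrow> x \<in> set bs" for x
      by (simp only: roots[symmetric] Cons.prems(3))
    have "a \<in> set (b # bs')" "b \<in> set (a # as)"
      using same[of a] same[of b] unfolding Cons by auto
    then have "a = b"
      using Cons.prems(1,2) unfolding Cons by force
    then have "(\<Prod>a\<leftarrow>as. [:- a, 1:]) = (\<Prod>b\<leftarrow>bs'. [:- b, 1:])"
      using Cons.prems(3) unfolding Cons by (simp del: mult_pCons_left)
    then show ?thesis
      using Cons.IH[of bs'] Cons.prems(1,2) \<open>a = b\<close> unfolding Cons by simp
  qed
qed

lemma eigvals_desc_symmetric:
  fixes A :: "real mat"
  assumes A: "A \<in> carrier_mat n n" and sym: "\<And>i j. i < n \<Longrightarrow> j < n \<Longrightarrow> A $$ (i, j) = A $$ (j, i)"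
  shows "sorted_wrt (\<ge>) (eigvals_desc A)"
    and "char_poly A = (\<Prod>a\<leftarrow>eigvals_desc A. [:- a, 1:])"
    and "length (eigvals_desc A) = n"
proof -
  have "\<exists>!es. sorted_wrt (\<ge>) es \<and> char_poly A = (\<Prod>a\<leftarrow>es. [:- a, 1:])"
    using char_poly_symmetric_splits[OF A sym] by (metis sorted_linear_factors_unique)
  then have *: "sorted_wrt (\<ge>) (eigvals_desc A) \<and> char_poly A = (\<Prod>a\<leftarrow>eigvals_desc A. [:- a, 1:])"
    unfolding eigvals_desc_def by (rule theI')
  then show "sorted_wrt (\<ge>) (eigvals_desc A)" "char_poly A = (\<Prod>a\<leftarrow>eigvals_desc A. [:- a, 1:])"
    by auto
  show "length (eigvals_desc A) = n"
    using degree_monic_char_poly[OF A] degree_linear_factors[of uminus "eigvals_desc A"] * by simp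
qed

text \<open>Complete \<open>v\<close> to a basis, apply Gram-Schmidt, which leaves the first vector
  unchanged, and normalise the columns.\<close>

lemma orthogonal_mat_with_first_col:
  fixes v :: "real vec"
  assumes v: "v \<in> carrier_vec n" "v \<noteq> 0\<^sub>v n"
  shows "\<exists>W c. W \<in> carrier_mat n n \<and> W\<^sup>T * W = 1\<^sub>m n \<and> col W 0 = c \<cdot>\<^sub>v v"
proof -
  have n: "0 < n"
    using v by (cases n) auto
  interpret cof_vec_space n "TYPE(real)" .
  define b where "b = basis_completion v"
  note bc = basis_completion[OF v, folded b_def]
  obtain vs where bv: "b = v # vs"
    using bc(6,7) n by (cases b) auto
  define ws where "ws = gram_schmidt n b"
  note gs = gram_schmidt_result[OF bc(2,4,5) ws_def]
  have len: "length ws = n"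
    using gs(4) bc(6) by simp
  have "hd ws = v"
    unfolding ws_def bv by (rule gram_schmidt_hd[OF v(1)])
  then have ws0: "ws ! 0 = v"
    using n len by (cases ws) auto
  have carr: "ws ! i \<in> carrier_vec n" if "i < n" for i
    using gs(3) len that nth_mem by blast
  \<comment> \<open>Conjugation is trivial over the reals, so \<open>corthogonal\<close> means
    ordinary orthogonality of nonzero vectors.\<close>
  have orth: "ws ! i \<bullet> ws ! j = 0 \<longleftrightarrow> i \<noteq> j" if "i < n" "j < n" for i j
    using corthogonalD[OF gs(2), of i j] that len by simp
  define d where "d j = sqrt (ws ! j \<bullet> ws ! j)" for j
  have d: "d j \<noteq> 0" "(d j)\<^sup>2 = ws ! j \<bullet> ws ! j" if "j < n" for j
  proof -
    have "0 \<le> ws ! j \<bullet> ws ! j"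
      by (auto simp: scalar_prod_def intro: sum_nonneg)
    then show "d j \<noteq> 0" "(d j)\<^sup>2 = ws ! j \<bullet> ws ! j"
      using orth[OF that that] by (auto simp: d_def)
  qed
  define W where "W = mat n n (\<lambda>(i, j). ws ! j $ i / d j)"
  have W: "W \<in> carrier_mat n n"
    by (simp add: W_def)
  have "W\<^sup>T * W = 1\<^sub>m n"
  proof (rule eq_matI)
    fix i j assume ij: "i < dim_row (1\<^sub>m n)" "j < dim_col (1\<^sub>m n)"
    then have "(W\<^sup>T * W) $$ (i, j) = (\<Sum>k = 0..<n. (ws ! i $ k / d i) * (ws ! j $ k / d j))"
      by (simp add: W_def scalar_prod_def)
    also have "\<dots> = (ws ! i \<bullet> ws ! j) / (d i * d j)"
      using carr[of j] ij by (simp add: scalar_prod_def sum_divide_distrib)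
    also have "\<dots> = (if i = j then 1 else 0)"
      using orth[of i j] d[of i] ij by (auto simp: power2_eq_square)
    finally show "(W\<^sup>T * W) $$ (i, j) = 1\<^sub>m n $$ (i, j)"
      using ij by simp
  qed (use W in auto)
  moreover have "col W 0 = (1 / d 0) \<cdot>\<^sub>v v"
    using n v(1) by (intro eq_vecI) (auto simp: W_def ws0)
  ultimately show ?thesis
    using W by blast
qed

text \<open>Deflation along the list \<open>es\<close>: an orthogonal \<open>W\<close> with an
  eigenvector for the head as first column turns \<open>A\<close> into the block diagonal of
  \<open>e\<close> and a symmetric \<open>A3\<close> with the remaining roots. The diagonal thus
  lists \<open>es\<close> in the given order, which keeps eigenvalues sorted.\<close>

lemma real_spectral_theorem:
  fixes A :: "real mat"
  assumes "A \<in> carrier_mat n n" and "A\<^sup>T = A" and "char_poly A = (\<Prod>a\<leftarrow>es. [:- a, 1:])"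
  shows "\<exists>U. U \<in> carrier_mat n n \<and> U\<^sup>T * U = 1\<^sub>m n \<and> U\<^sup>T * A * U = mat_diag n ((!) es)"
  using assms
proof (induction es arbitrary: n A)
  case Nil
  then have "n = 0"
    using degree_monic_char_poly[of A n] by simp
  then show ?case
    using Nil.prems by (intro exI[of _ "1\<^sub>m 0"]) (auto simp: mat_diag_def intro!: eq_matI)
next
  case (Cons e es n A)
  note A = Cons.prems(1)
  define m where "m = n - 1"
  have "degree (char_poly A) = Suc (length es)"
    using degree_linear_factors[of uminus "e # es"] Cons.prems(3) by simp
  then have n: "n = Suc m"
    using degree_monic_char_poly[OF A] by (simp add: m_def)
  have "eigenvalue A e"
    unfolding eigenvalue_root_char_poly[OF A] Cons.prems(3) by simp
  then obtain v where v: "v \<in> carrier_vec n" "v \<noteq> 0\<^sub>v n" and Av: "A *\<^sub>v v = e \<cdot>\<^sub>v v"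
    using A unfolding eigenvalue_def eigenvector_def by auto
  obtain W c where W: "W \<in> carrier_mat n n" and WW: "W\<^sup>T * W = 1\<^sub>m n" and W0: "col W 0 = c \<cdot>\<^sub>v v"
    using orthogonal_mat_with_first_col[OF v] by blast
  have WT: "W\<^sup>T \<in> carrier_mat n n"
    using W by simp
  have WW': "W * W\<^sup>T = 1\<^sub>m n"
    using mat_mult_left_right_inverse[OF WT W WW] .
  define B where "B = W\<^sup>T * A * W"
  have B: "B \<in> carrier_mat n n"
    using A W by (simp add: B_def)
  have BT: "B\<^sup>T = B"
    unfolding B_def using A W WT Cons.prems(2)
    by (simp add: transpose_mult[of _ n n _ n] assoc_mult_mat[of _ n n _ n _ n])
  have AW0: "A *\<^sub>v col W 0 = e \<cdot>\<^sub>v col W 0"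
    unfolding W0 using A v Av by (simp add: mult_mat_vec smult_smult_assoc mult.commute)
  have col0: "B $$ (i, 0) = (if i = 0 then e else 0)" if i: "i < n" for i
  proof -
    have "B $$ (i, 0) = row (W\<^sup>T) i \<bullet> col (A * W) 0"
      using i n A W by (simp add: B_def assoc_mult_mat[of _ n n _ n _ n])
    also have "col (A * W) 0 = e \<cdot>\<^sub>v col W 0"
      unfolding AW0[symmetric] using A W n by (intro col_mult2) auto
    also have "row (W\<^sup>T) i \<bullet> (e \<cdot>\<^sub>v col W 0) = e * (row (W\<^sup>T) i \<bullet> col W 0)"
      using W by (intro scalar_prod_smult_distrib[of _ n]) (auto simp: i)
    also have "row (W\<^sup>T) i \<bullet> col W 0 = (W\<^sup>T * W) $$ (i, 0)"
      using W i n by simp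
    finally show ?thesis
      using i n by (simp add: WW)
  qed
  have row0: "B $$ (0, i) = (if i = 0 then e else 0)" if i: "i < n" for i
  proof -
    have "B $$ (0, i) = B\<^sup>T $$ (i, 0)"
      using i n B by simp
    then show ?thesis
      using col0[OF i] by (simp only: BT)
  qed
  define A3 where "A3 = mat m m (\<lambda>(i, j). B $$ (Suc i, Suc j))"
  have A3: "A3 \<in> carrier_mat m m"
    by (simp add: A3_def)
  have A3T: "A3\<^sup>T = A3"
  proof (rule eq_matI)
    fix i j assume ij: "i < dim_row A3" "j < dim_col A3"
    then have "B\<^sup>T $$ (Suc i, Suc j) = B $$ (Suc j, Suc i)"
      using B n by (simp add: A3_def)
    then show "A3\<^sup>T $$ (i, j) = A3 $$ (i, j)"
      using ij by (simp add: A3_def BT)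
  qed (simp_all add: A3_def)
  define E where "E = mat 1 1 (\<lambda>_. e)"
  have E: "E \<in> carrier_mat 1 1"
    by (simp add: E_def)
  have block: "B = four_block_mat E (0\<^sub>m 1 m) (0\<^sub>m m 1) A3"
    using B n col0 row0 by (intro eq_matI) (auto simp: E_def A3_def)
  have "similar_mat_wit B A (W\<^sup>T) W"
    using A B W WT WW WW' by (intro similar_mat_witI[of "W\<^sup>T" W n B A]) (simp_all add: B_def)
  then have "similar_mat B A"
    unfolding similar_mat_def by blast
  then have "char_poly B = [:- e, 1:] * (\<Prod>a\<leftarrow>es. [:- a, 1:])"
    using char_poly_similar Cons.prems(3) by fastforce
  moreover have "char_poly B = char_poly E * char_poly A3"
    unfolding block by (rule char_poly_four_block_zeros_col[OF E _ A3]) simp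
  moreover have "char_poly E = [:- e, 1:]"
    by (simp add: E_def char_poly_defs det_def sign_def)
  ultimately have "char_poly A3 = (\<Prod>a\<leftarrow>es. [:- a, 1:])"
    by (metis mult_cancel_left pCons_eq_0_iff zero_neq_one)
  then obtain U where U: "U \<in> carrier_mat m m" and UU: "U\<^sup>T * U = 1\<^sub>m m"
    and UA: "U\<^sup>T * A3 * U = mat_diag m ((!) es)"
    using Cons.IH[OF A3 A3T] by blast
  \<comment> \<open>\<open>F\<close> extends the diagonaliser of \<open>A3\<close> by 1 in the
    corner; \<open>W * F\<close> then diagonalises \<open>A\<close>.\<close>
  define F where "F = four_block_mat (1\<^sub>m 1) (0\<^sub>m 1 m) (0\<^sub>m m 1) U"
  have F: "F \<in> carrier_mat n n"
    using U n by (auto simp: F_def)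
  have FT: "F\<^sup>T = four_block_mat (1\<^sub>m 1) (0\<^sub>m 1 m) (0\<^sub>m m 1) (U\<^sup>T)"
    unfolding F_def using U
    by (subst transpose_four_block_mat[of _ 1 1 _ m _ m]) auto
  have FF: "F\<^sup>T * F = 1\<^sub>m n"
    unfolding FT unfolding F_def using U n UU
    by (subst mult_four_block_mat[of _ 1 1 _ m _ m _ _ 1 _ m]) (auto simp: four_block_one_mat)
  have FBF: "F\<^sup>T * B * F = mat_diag n ((!) (e # es))"
  proof -
    have "F\<^sup>T * B = four_block_mat E (0\<^sub>m 1 m) (0\<^sub>m m 1) (U\<^sup>T * A3)"
      unfolding FT block using U E A3
      by (subst mult_four_block_mat[of _ 1 1 _ m _ m _ _ 1 _ m]) auto
    moreover have "four_block_mat E (0\<^sub>m 1 m) (0\<^sub>m m 1) (U\<^sup>T * A3) * F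
        = four_block_mat E (0\<^sub>m 1 m) (0\<^sub>m m 1) (U\<^sup>T * A3 * U)"
      unfolding F_def using U E A3
      by (subst mult_four_block_mat[of _ 1 1 _ m _ m _ _ 1 _ m]) auto
    moreover have "four_block_mat E (0\<^sub>m 1 m) (0\<^sub>m m 1) (mat_diag m ((!) es)) = mat_diag n ((!) (e # es))"
      using n by (intro eq_matI) (auto simp: E_def mat_diag_def)
    ultimately show ?thesis
      by (simp add: UA)
  qed
  have T: "(W * F)\<^sup>T = F\<^sup>T * W\<^sup>T"
    using W F by (rule transpose_mult)
  have FTc: "F\<^sup>T \<in> carrier_mat n n"
    using F by simp
  have "(W * F)\<^sup>T * (W * F) = F\<^sup>T * (W\<^sup>T * W) * F"
    unfolding T using W F WT FTc by (simp add: assoc_mult_mat[of _ n n _ n _ n])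
  then have "(W * F)\<^sup>T * (W * F) = 1\<^sub>m n"
    using FTc by (simp add: WW FF)
  moreover have "(W * F)\<^sup>T * A * (W * F) = F\<^sup>T * B * F"
    unfolding T B_def using A W F WT FTc by (simp add: assoc_mult_mat[of _ n n _ n _ n])
  ultimately show ?case
    using W F FBF by (intro exI[of _ "W * F"]) auto
qed

section \<open>Eigenvalue bounds from test spaces\<close>

definition quad_form :: "real mat \<Rightarrow> (nat \<Rightarrow> real) \<Rightarrow> real" where
  "quad_form A a = (\<Sum>i<dim_row A. \<Sum>k<dim_col A. A $$ (i, k) * a i * a k)"

text \<open>The spectral theorem in coordinates: orthonormal columns, Parseval's identity and the
  diagonalised quadratic form, ready for the min-max arguments.\<close>

lemma symmetric_eigenbasis:
  fixes A :: "real mat"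
  assumes A: "A \<in> carrier_mat n n" and sym: "\<And>i j. i < n \<Longrightarrow> j < n \<Longrightarrow> A $$ (i, j) = A $$ (j, i)"
  shows "\<exists>u :: nat \<Rightarrow> nat \<Rightarrow> real.
    (\<forall>k<n. \<forall>l<n. (\<Sum>i<n. u i k * u i l) = (if k = l then 1 else 0)) \<and>
    (\<forall>a. (\<Sum>i<n. (a i)\<^sup>2) = (\<Sum>l<n. (\<Sum>i<n. u i l * a i)\<^sup>2)) \<and>
    (\<forall>a. quad_form A a = (\<Sum>l<n. eigvals_desc A ! l * (\<Sum>i<n. u i l * a i)\<^sup>2))"
proof -
  let ?D = "mat_diag n ((!) (eigvals_desc A))"
  have "A\<^sup>T = A"
    using A sym by (intro eq_matI) auto
  then obtain U where U: "U \<in> carrier_mat n n" and UU: "U\<^sup>T * U = 1\<^sub>m n"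
    and UA: "U\<^sup>T * A * U = ?D"
    using real_spectral_theorem[OF A _ eigvals_desc_symmetric(2)[OF A sym]] by blast
  have UT: "U\<^sup>T \<in> carrier_mat n n"
    using U by simp
  have UU': "U * U\<^sup>T = 1\<^sub>m n"
    using mat_mult_left_right_inverse[OF UT U UU] .
  have "U * ?D * U\<^sup>T = (U * U\<^sup>T) * A * (U * U\<^sup>T)"
    unfolding UA[symmetric] using A U UT by (simp add: assoc_mult_mat[of _ n n _ n _ n])
  then have AU: "A = U * ?D * U\<^sup>T"
    using A by (simp add: UU')
  define u where "u i l = U $$ (i, l)" for i l
  have col_orth: "(\<Sum>i<n. u i k * u i l) = (if k = l then 1 else 0)" if "k < n" "l < n" for k l
  proof -
    have "(\<Sum>i<n. u i k * u i l) = (U\<^sup>T * U) $$ (k, l)"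
      using that U by (simp add: u_def scalar_prod_def lessThan_atLeast0)
    then show ?thesis
      using that by (simp add: UU)
  qed
  have row_orth: "(\<Sum>l<n. u i l * u k l) = (if i = k then 1 else 0)" if "i < n" "k < n" for i k
  proof -
    have "(\<Sum>l<n. u i l * u k l) = (U * U\<^sup>T) $$ (i, k)"
      using that U by (simp add: u_def scalar_prod_def lessThan_atLeast0)
    then show ?thesis
      using that by (simp add: UU')
  qed
  have entry: "A $$ (i, k) = (\<Sum>l<n. eigvals_desc A ! l * u i l * u k l)" if "i < n" "k < n" for i k
  proof -
    have "A $$ (i, k) = (U * ?D * U\<^sup>T) $$ (i, k)"
      using AU by simp
    also have "\<dots> = (\<Sum>l<n. eigvals_desc A ! l * u i l * u k l)"
      unfolding mat_diag_mult_right[OF U] using that U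
      by (simp add: u_def scalar_prod_def lessThan_atLeast0 mult_ac)
    finally show ?thesis .
  qed
  \<comment> \<open>Unit weights give Parseval through orthonormality of the rows; the eigenvalues
    as weights give the quadratic form.\<close>
  have expand: "(\<Sum>l<n. w l * (\<Sum>i<n. u i l * a i)\<^sup>2) = (\<Sum>i<n. \<Sum>k<n. (\<Sum>l<n. w l * u i l * u k l) * a i * a k)"
    for w a :: "nat \<Rightarrow> real"
  proof -
    have "(\<Sum>l<n. w l * (\<Sum>i<n. u i l * a i)\<^sup>2)
        = (\<Sum>l<n. \<Sum>i<n. \<Sum>k<n. w l * u i l * u k l * a i * a k)"
      unfolding power2_eq_square sum_product unfolding sum_distrib_left by (intro sum.cong refl) (simp only: mult_ac)
    also have "\<dots> = (\<Sum>i<n. \<Sum>l<n. \<Sum>k<n. w l * u i l * u k l * a i * a k)"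
      by (rule sum.swap)
    also have "\<dots> = (\<Sum>i<n. \<Sum>k<n. \<Sum>l<n. w l * u i l * u k l * a i * a k)"
      by (intro sum.cong refl sum.swap)
    finally show ?thesis
      by (simp only: sum_distrib_right)
  qed
  show ?thesis
  proof (intro exI[of _ u] conjI allI impI)
    show "(\<Sum>i<n. (a i)\<^sup>2) = (\<Sum>l<n. (\<Sum>i<n. u i l * a i)\<^sup>2)" for a
    proof -
      have "(\<Sum>l<n. (\<Sum>i<n. u i l * a i)\<^sup>2) = (\<Sum>i<n. \<Sum>k<n. (\<Sum>l<n. u i l * u k l) * a i * a k)"
        using expand[of "\<lambda>_. 1" a] by simp
      also have "\<dots> = (\<Sum>i<n. \<Sum>k<n. if i = k then a i * a k else 0)"
        by (intro sum.cong refl) (simp add: row_orth)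
      also have "\<dots> = (\<Sum>i<n. (a i)\<^sup>2)"
        by (simp add: power2_eq_square)
      finally show ?thesis ..
    qed
    show "quad_form A a = (\<Sum>l<n. eigvals_desc A ! l * (\<Sum>i<n. u i l * a i)\<^sup>2)" for a
      unfolding expand quad_form_def using A by (simp add: entry)
  qed (use col_orth in auto)
qed

text \<open>There is one more unknown than equations: a zero row makes the system square and
  singular.\<close>

lemma homogeneous_system_nontrivial_solution:
  fixes c :: "nat \<Rightarrow> nat \<Rightarrow> real"
  shows "\<exists>x. (\<exists>k\<le>j. x k \<noteq> 0) \<and> (\<forall>i<j. (\<Sum>k\<le>j. c i k * x k) = 0)"
proof -
  define M where "M = mat\<^sub>r (Suc j) (Suc j) (\<lambda>i. if i = j then 0\<^sub>v (Suc j) else vec (Suc j) (c i))"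
  have M: "M \<in> carrier_mat (Suc j) (Suc j)"
    by (simp add: M_def)
  have "det M = 0"
    unfolding M_def by (rule det_row_0) auto
  then obtain v where v: "v \<in> carrier_vec (Suc j)" "v \<noteq> 0\<^sub>v (Suc j)" and Mv: "M *\<^sub>v v = 0\<^sub>v (Suc j)"
    using det_0_iff_vec_prod_zero[OF M] by blast
  show ?thesis
  proof (intro exI[of _ "\<lambda>k. v $ k"] conjI allI impI)
    have "\<exists>k<Suc j. v $ k \<noteq> 0"
      using v by (metis carrier_vecD eq_vecI index_zero_vec)
    then show "\<exists>k\<le>j. v $ k \<noteq> 0"
      by (auto simp: less_Suc_eq_le)
    fix i assume i: "i < j"
    have "(M *\<^sub>v v) $ i = (\<Sum>k\<le>j. c i k * v $ k)"
      using i v M by (simp add: M_def scalar_prod_def lessThan_Suc_atMost flip: lessThan_atLeast0)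
    then show "(\<Sum>k\<le>j. c i k * v $ k) = 0"
      using i by (simp add: Mv)
  qed
qed

section \<open>Min-max bounds for single eigenvalues\<close>

lemma eigvals_desc_antimono:
  fixes A :: "real mat"
  assumes A: "A \<in> carrier_mat n n" and sym: "\<And>i j. i < n \<Longrightarrow> j < n \<Longrightarrow> A $$ (i, j) = A $$ (j, i)"
    and "k \<le> l" "l < n"
  shows "eigvals_desc A ! l \<le> eigvals_desc A ! k"
  using eigvals_desc_symmetric(1,3)[OF A sym] assms(3,4)
  by (cases "k = l") (auto simp: sorted_wrt_iff_nth_less)

text \<open>Some nonzero combination of the \<open>j + 1\<close> test vectors is orthogonal to the
  first \<open>j\<close> eigenvectors; on such vectors the form is at most the eigenvalue number
  \<open>j\<close>, counted from 0, times the squared norm.\<close>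

lemma eigval_ge_of_test_space:
  fixes A :: "real mat"
  assumes A: "A \<in> carrier_mat n n" and sym: "\<And>i j. i < n \<Longrightarrow> j < n \<Longrightarrow> A $$ (i, j) = A $$ (j, i)"
    and j: "j < n"
    and indep: "\<And>x. (\<Sum>i<n. (\<Sum>k\<le>j. x k * w k i)\<^sup>2) = 0 \<Longrightarrow> \<forall>k\<le>j. x k = 0"
    and ge: "\<And>x. \<alpha> * (\<Sum>i<n. (\<Sum>k\<le>j. x k * w k i)\<^sup>2) \<le> quad_form A (\<lambda>i. \<Sum>k\<le>j. x k * w k i)"
  shows "\<alpha> \<le> eigvals_desc A ! j"
proof -
  obtain u where norm: "\<forall>a. (\<Sum>i<n. (a i)\<^sup>2) = (\<Sum>l<n. (\<Sum>i<n. u i l * a i)\<^sup>2)"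
    and quad: "\<forall>a. quad_form A a = (\<Sum>l<n. eigvals_desc A ! l * (\<Sum>i<n. u i l * a i)\<^sup>2)"
    using symmetric_eigenbasis[OF A sym] by blast
  obtain x where x: "\<exists>k\<le>j. x k \<noteq> 0"
    and x0: "\<forall>l<j. (\<Sum>k\<le>j. (\<Sum>i<n. u i l * w k i) * x k) = 0"
    using homogeneous_system_nontrivial_solution[of j "\<lambda>l k. \<Sum>i<n. u i l * w k i"] by blast
  define a where "a i = (\<Sum>k\<le>j. x k * w k i)" for i
  have coord0: "(\<Sum>i<n. u i l * a i) = 0" if "l < j" for l
  proof -
    have "(\<Sum>i<n. u i l * a i) = (\<Sum>k\<le>j. (\<Sum>i<n. u i l * w k i) * x k)"
      unfolding a_def sum_distrib_left sum_distrib_right by (subst sum.swap) (simp only: mult_ac)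
    then show ?thesis
      using x0 that by simp
  qed
  have "\<alpha> * (\<Sum>i<n. (a i)\<^sup>2) \<le> quad_form A a"
    unfolding a_def by (rule ge)
  also have "\<dots> \<le> (\<Sum>l<n. eigvals_desc A ! j * (\<Sum>i<n. u i l * a i)\<^sup>2)"
    unfolding quad[rule_format]
  proof (rule sum_mono)
    fix l assume l: "l \<in> {..<n}"
    show "eigvals_desc A ! l * (\<Sum>i<n. u i l * a i)\<^sup>2 \<le> eigvals_desc A ! j * (\<Sum>i<n. u i l * a i)\<^sup>2"
    proof (cases "l < j")
      case False
      then show ?thesis
        using l by (intro mult_right_mono eigvals_desc_antimono[OF A sym]) auto
    qed (simp add: coord0)
  qed
  also have "\<dots> = eigvals_desc A ! j * (\<Sum>i<n. (a i)\<^sup>2)"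
    by (simp only: norm[rule_format, of a] sum_distrib_left)
  finally have "\<alpha> * (\<Sum>i<n. (a i)\<^sup>2) \<le> eigvals_desc A ! j * (\<Sum>i<n. (a i)\<^sup>2)" .
  moreover have "0 < (\<Sum>i<n. (a i)\<^sup>2)"
    using indep[of x] x sum_nonneg[of "{..<n}" "\<lambda>i. (a i)\<^sup>2"] unfolding a_def[symmetric] by force
  ultimately show ?thesis
    by simp
qed

text \<open>Dually, the span of the first \<open>j + 1\<close> eigenvectors contains a nonzero
  vector meeting all \<open>j\<close> constraints, and there the form is at least the eigenvalue
  number \<open>j\<close> times the squared norm.\<close>

lemma eigval_le_of_constraints:
  fixes A :: "real mat"
  assumes A: "A \<in> carrier_mat n n" and sym: "\<And>i j. i < n \<Longrightarrow> j < n \<Longrightarrow> A $$ (i, j) = A $$ (j, i)"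
    and j: "j < n"
    and le: "\<And>a. (\<And>c. c < j \<Longrightarrow> (\<Sum>i<n. \<phi> c i * a i) = 0) \<Longrightarrow> quad_form A a \<le> \<beta> * (\<Sum>i<n. (a i)\<^sup>2)"
  shows "eigvals_desc A ! j \<le> \<beta>"
proof -
  obtain u where orth: "\<forall>k<n. \<forall>l<n. (\<Sum>i<n. u i k * u i l) = (if k = l then 1 else 0)"
    and norm: "\<forall>a. (\<Sum>i<n. (a i)\<^sup>2) = (\<Sum>l<n. (\<Sum>i<n. u i l * a i)\<^sup>2)"
    and quad: "\<forall>a. quad_form A a = (\<Sum>l<n. eigvals_desc A ! l * (\<Sum>i<n. u i l * a i)\<^sup>2)"
    using symmetric_eigenbasis[OF A sym] by blast
  obtain x where x: "\<exists>k\<le>j. x k \<noteq> 0"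
    and x0: "\<forall>c<j. (\<Sum>k\<le>j. (\<Sum>i<n. \<phi> c i * u i k) * x k) = 0"
    using homogeneous_system_nontrivial_solution[of j "\<lambda>c k. \<Sum>i<n. \<phi> c i * u i k"] by blast
  define a where "a i = (\<Sum>k\<le>j. x k * u i k)" for i
  have coord: "(\<Sum>i<n. u i l * a i) = (if l \<le> j then x l else 0)" if l: "l < n" for l
  proof -
    have "(\<Sum>i<n. u i l * a i) = (\<Sum>k\<le>j. (\<Sum>i<n. u i l * u i k) * x k)"
      unfolding a_def sum_distrib_left sum_distrib_right by (subst sum.swap) (simp only: mult_ac)
    also have "\<dots> = (\<Sum>k\<le>j. if l = k then x k else 0)"
      using l j by (intro sum.cong) (auto simp: orth)
    finally show ?thesis
      by (simp add: sum.delta)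
  qed
  have "eigvals_desc A ! j * (\<Sum>i<n. (a i)\<^sup>2) = (\<Sum>l<n. eigvals_desc A ! j * (\<Sum>i<n. u i l * a i)\<^sup>2)"
    by (simp only: norm[rule_format, of a] sum_distrib_left)
  also have "\<dots> \<le> quad_form A a"
    unfolding quad[rule_format]
  proof (rule sum_mono)
    fix l assume l: "l \<in> {..<n}"
    show "eigvals_desc A ! j * (\<Sum>i<n. u i l * a i)\<^sup>2 \<le> eigvals_desc A ! l * (\<Sum>i<n. u i l * a i)\<^sup>2"
    proof (cases "l \<le> j")
      case True
      then show ?thesis
        using j by (intro mult_right_mono eigvals_desc_antimono[OF A sym]) auto
    qed (use l in \<open>simp add: coord\<close>)
  qed
  also have "\<dots> \<le> \<beta> * (\<Sum>i<n. (a i)\<^sup>2)"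
  proof (rule le)
    fix c assume c: "c < j"
    have "(\<Sum>i<n. \<phi> c i * a i) = (\<Sum>k\<le>j. (\<Sum>i<n. \<phi> c i * u i k) * x k)"
      unfolding a_def sum_distrib_left sum_distrib_right by (subst sum.swap) (simp only: mult_ac)
    then show "(\<Sum>i<n. \<phi> c i * a i) = 0"
      using x0 c by simp
  qed
  finally have "eigvals_desc A ! j * (\<Sum>i<n. (a i)\<^sup>2) \<le> \<beta> * (\<Sum>i<n. (a i)\<^sup>2)" .
  moreover have "0 < (\<Sum>i<n. (a i)\<^sup>2)"
  proof -
    obtain k where k: "k \<le> j" "x k \<noteq> 0"
      using x by blast
    then have "0 < (\<Sum>i<n. u i k * a i)\<^sup>2"
      using j by (simp add: coord)
    also have "\<dots> \<le> (\<Sum>l<n. (\<Sum>i<n. u i l * a i)\<^sup>2)"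
      using k j by (intro member_le_sum) auto
    finally show ?thesis
      by (simp only: norm[rule_format, of a])
  qed
  ultimately show ?thesis
    by simp
qed

section \<open>The Gram matrix as a spline energy\<close>

lemma continuous_on_relu_pow [continuous_intros]:
  "continuous_on S f \<Longrightarrow> continuous_on S (\<lambda>x. relu_pow n (f x))"
  unfolding relu_pow_def by (intro continuous_intros)

text \<open>The exponent starts at 2 because exponent 1 has a kink at the origin. Away from 0 the
  function is locally zero or a monomial.\<close>

lemma relu_pow_has_derivative:
  "(relu_pow (Suc (Suc n)) has_real_derivative real (Suc (Suc n)) * relu_pow (Suc n) z) (at z)"
proof -
  consider "z < 0" | "z = 0" | "z > 0" by linarith
  then show ?thesis
  proof cases
    case 1
    have "((\<lambda>_. 0) has_real_derivative 0) (at z)"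
      by simp
    then have "(relu_pow (Suc (Suc n)) has_real_derivative 0) (at z)"
      by (rule has_field_derivative_transform_within_open[of _ _ _ "{..<0}"])
         (use 1 in \<open>auto simp: relu_pow_def\<close>)
    then show ?thesis
      using 1 by (simp add: relu_pow_def)
  next
    case 2
    have "continuous_on UNIV (relu_pow (Suc n))"
      using continuous_on_relu_pow[OF continuous_on_id] by simp
    then have "relu_pow (Suc n) \<midarrow>0\<rightarrow> relu_pow (Suc n) 0"
      by (simp add: continuous_on_def)
    then have "relu_pow (Suc n) \<midarrow>0\<rightarrow> 0"
      by (simp add: relu_pow_def)
    \<comment> \<open>At the origin the difference quotient is exactly the next lower ReLU power,
      which is continuous and vanishes there.\<close>
    moreover have "\<forall>\<^sub>F h in at 0. relu_pow (Suc n) h = (relu_pow (Suc (Suc n)) (0 + h) - relu_pow (Suc (Suc n)) 0) / h"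
      by (rule eventually_at_filter[THEN iffD2, OF always_eventually]) (auto simp: relu_pow_def max_def)
    ultimately have "(\<lambda>h. (relu_pow (Suc (Suc n)) (0 + h) - relu_pow (Suc (Suc n)) 0) / h) \<midarrow>0\<rightarrow> 0"
      by (rule Lim_transform_eventually)
    then show ?thesis
      using 2 by (simp add: DERIV_def relu_pow_def)
  next
    case 3
    have "((\<lambda>z. z ^ Suc (Suc n)) has_real_derivative real (Suc (Suc n)) * z ^ Suc n) (at z)"
      using DERIV_pow[of "Suc (Suc n)" z] by simp
    then have "(relu_pow (Suc (Suc n)) has_real_derivative real (Suc (Suc n)) * z ^ Suc n) (at z)"
      by (rule has_field_derivative_transform_within_open[of _ _ _ "{0<..}"])
         (use 3 in \<open>auto simp: relu_pow_def max_def\<close>)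
    then show ?thesis
      using 3 by (simp add: relu_pow_def max_def)
  qed
qed

text \<open>\<open>k < p\<close> ensures that each differentiation meets an exponent of at least
  2.\<close>

lemma deriv_iterate_relu_pow:
  assumes "k < p"
  shows "(deriv ^^ k) (relu_pow p) = (\<lambda>z. fact p / fact (p - k) * relu_pow (p - k) z)"
  using assms
proof (induction k)
  case (Suc k)
  obtain n where n: "p - k = Suc (Suc n)"
    using Suc.prems by (metis Suc_diff_Suc Suc_lessD)
  then have n': "p - Suc k = Suc n"
    by simp
  have "(deriv ^^ Suc k) (relu_pow p) = deriv (\<lambda>z. fact p / fact (Suc (Suc n)) * relu_pow (Suc (Suc n)) z)"
    using Suc by (simp add: n)
  also have "\<dots> = (\<lambda>z. fact p / fact (Suc (Suc n)) * (real (Suc (Suc n)) * relu_pow (Suc n) z))"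
    by (intro ext DERIV_imp_deriv DERIV_cmult relu_pow_has_derivative)
  also have "\<dots> = (\<lambda>z. fact p / fact (p - Suc k) * relu_pow (p - Suc k) z)"
    unfolding n' by (intro ext) (simp add: field_simps del: of_nat_Suc)
  finally show ?case .
qed simp

section \<open>Rescaling the Gram form to unit cells\<close>

lemma integral_split_grid:
  fixes g :: "real \<Rightarrow> real"
  assumes g: "continuous_on UNIV g" and h: "0 \<le> h"
  shows "integral {u..u + h * real n} g = (\<Sum>m<n. integral {u + h * real m..u + h * real (Suc m)} g)"
proof (induction n)
  case (Suc n)
  have "integral {u..u + h * real n} g + integral {u + h * real n..u + h * real (Suc n)} g
      = integral {u..u + h * real (Suc n)} g"
    using h by (intro integral_combine integrable_continuous_real continuous_on_subset[OF g])
      (auto simp: algebra_simps)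
  then show ?case
    using Suc by simp
qed simp

lemma integral_affine_unit:
  fixes g :: "real \<Rightarrow> real"
  assumes g: "continuous_on UNIV g" and h: "0 < h"
  shows "integral {u..u + h} g = h * integral {0..1} (\<lambda>t. g (h * t + u))"
proof -
  have "(g has_integral integral {u..u + h} g) (cbox u (u + h))"
    by (auto intro!: integrable_integral integrable_continuous_real continuous_on_subset[OF g])
  from has_integral_affinity'[OF this h, of u]
  have "((\<lambda>t. g (h * t + u)) has_integral integral {u..u + h} g / h) {0..1}"
    using h by (simp add: divide_inverse mult.commute)
  then show ?thesis
    using h by (simp add: integral_unique)
qed

text \<open>Knots to the right of the cell contribute \<open>0 ^ q\<close>, which is 0 for positive
  \<open>q\<close>; homogeneity of the ReLU power extracts \<open>h ^ q\<close> from the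
  others.\<close>

lemma relu_combination_on_cell:
  assumes q: "0 < q" and m: "m < N" and t: "0 \<le> t" "t \<le> 1"
  defines "h \<equiv> 2 / real N"
  shows "(\<Sum>i<N. a i * relu_pow q (h * t + bpt N m - bpt N i)) = h ^ q * spline_piece q a m t"
proof -
  have h: "0 < h"
    using m by (simp add: h_def)
  have diff: "h * t + bpt N m - bpt N i = h * (real m - real i + t)" for i
    by (simp add: bpt_def h_def algebra_simps diff_divide_distrib add_divide_distrib)
  have "(\<Sum>i<N. a i * relu_pow q (h * t + bpt N m - bpt N i)) = (\<Sum>i\<le>m. h ^ q * (a i * (real (m - i) + t) ^ q))"
  proof (rule sum.mono_neutral_cong_right)
    show "\<forall>i\<in>{..<N} - {..m}. a i * relu_pow q (h * t + bpt N m - bpt N i) = 0"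
    proof
      fix i assume "i \<in> {..<N} - {..m}"
      then have "real m - real i + t \<le> 0"
        using t by auto
      then have "h * (real m - real i + t) \<le> 0"
        using h by (simp add: mult_le_0_iff)
      then show "a i * relu_pow q (h * t + bpt N m - bpt N i) = 0"
        using q by (simp add: diff relu_pow_def)
    qed
    fix i assume i: "i \<in> {..m}"
    then have "relu_pow q (h * t + bpt N m - bpt N i) = (h * (real (m - i) + t)) ^ q"
      using h t by (simp add: diff relu_pow_def of_nat_diff)
    then show "a i * relu_pow q (h * t + bpt N m - bpt N i) = h ^ q * (a i * (real (m - i) + t) ^ q)"
      by (simp add: power_mult_distrib)
  qed (use m in auto)
  then show ?thesis
    by (simp add: spline_piece_def sum_distrib_left)
qed

lemma gram_carrier: "gram p k N \<in> carrier_mat N N"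
  by (simp add: gram_def)

lemma gram_sym: "i < N \<Longrightarrow> j < N \<Longrightarrow> gram p k N $$ (i, j) = gram p k N $$ (j, i)"
  by (simp add: gram_def mult.commute)

text \<open>The form is the integral of the squared combination of shifted derivatives. These give
  the factorials, homogeneity gives \<open>(2 / N) ^ (2 * q)\<close>, and the change of variables in
  each cell one more factor \<open>2 / N\<close>.\<close>

lemma quad_form_gram:
  assumes k: "k < p" and N: "0 < N"
  defines "q \<equiv> p - k"
  shows "quad_form (gram p k N) a
    = (fact p / fact q)\<^sup>2 * (2 / real N) ^ (2 * q + 1) * spline_energy q N a"
proof -
  define h where "h = 2 / real N"
  define c :: real where "c = fact p / fact q"
  define s where "s i x = relu_pow q (x - bpt N i)" for i x
  define f where "f x = (\<Sum>i<N. a i * s i x)" for x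
  have h: "0 < h" and q: "0 < q"
    using N k by (auto simp: h_def q_def)
  have s: "continuous_on S (s i)" for S i
    unfolding s_def by (intro continuous_intros)
  have f: "continuous_on UNIV (\<lambda>x. (f x)\<^sup>2)"
    unfolding f_def by (intro continuous_intros s)
  have entry: "gram p k N $$ (i, j) = c\<^sup>2 * integral {-1..1} (\<lambda>x. s i x * s j x)" if "i < N" "j < N" for i j
  proof -
    have "gram p k N $$ (i, j) = integral {-1..1} (\<lambda>x. c * s i x * (c * s j x))"
      using that unfolding gram_def deriv_iterate_relu_pow[OF k] by (simp add: c_def s_def q_def)
    also have "\<dots> = integral {-1..1} (\<lambda>x. c\<^sup>2 * (s i x * s j x))"
      by (simp add: power2_eq_square mult_ac)
    finally show ?thesis
      by simp
  qed
  have "(\<Sum>i<N. \<Sum>j<N. a i * a j * integral {-1..1} (\<lambda>x. s i x * s j x)) = integral {-1..1} (\<lambda>x. (f x)\<^sup>2)"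
  proof -
    have "(f x)\<^sup>2 = (\<Sum>i<N. \<Sum>j<N. a i * a j * (s i x * s j x))" for x
      unfolding f_def power2_eq_square sum_product by (intro sum.cong refl) (simp only: mult_ac)
    then have "integral {-1..1} (\<lambda>x. (f x)\<^sup>2)
        = integral {-1..1} (\<lambda>x. \<Sum>i<N. \<Sum>j<N. a i * a j * (s i x * s j x))"
      by simp
    also have "\<dots> = (\<Sum>i<N. integral {-1..1} (\<lambda>x. \<Sum>j<N. a i * a j * (s i x * s j x)))"
      by (intro Henstock_Kurzweil_Integration.integral_sum integrable_continuous_real continuous_intros s) auto
    also have "\<dots> = (\<Sum>i<N. \<Sum>j<N. integral {-1..1} (\<lambda>x. a i * a j * (s i x * s j x)))"
      by (intro sum.cong refl Henstock_Kurzweil_Integration.integral_sum integrable_continuous_real continuous_intros s) auto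
    finally show ?thesis
      by simp
  qed
  moreover have "quad_form (gram p k N) a = c\<^sup>2 * (\<Sum>i<N. \<Sum>j<N. a i * a j * integral {-1..1} (\<lambda>x. s i x * s j x))"
    unfolding quad_form_def sum_distrib_left using gram_carrier[of p k N]
    by (intro sum.cong) (auto simp: entry)
  ultimately have quad: "quad_form (gram p k N) a = c\<^sup>2 * integral {-1..1} (\<lambda>x. (f x)\<^sup>2)"
    by simp
  have grid: "-1 + h * real m = bpt N m" for m
    by (simp add: bpt_def h_def)
  have "integral {-1..1} (\<lambda>x. (f x)\<^sup>2) = integral {-1..-1 + h * real N} (\<lambda>x. (f x)\<^sup>2)"
    using N by (simp add: h_def)
  also have "\<dots> = (\<Sum>m<N. integral {-1 + h * real m..-1 + h * real (Suc m)} (\<lambda>x. (f x)\<^sup>2))"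
    using h by (intro integral_split_grid f) auto
  also have "\<dots> = (\<Sum>m<N. h ^ (2 * q + 1) * integral {0..1} (\<lambda>t. (spline_piece q a m t)\<^sup>2))"
  proof (intro sum.cong refl)
    fix m assume m: "m \<in> {..<N}"
    have "integral {-1 + h * real m..-1 + h * real (Suc m)} (\<lambda>x. (f x)\<^sup>2)
        = integral {bpt N m..bpt N m + h} (\<lambda>x. (f x)\<^sup>2)"
      by (simp add: algebra_simps flip: grid)
    also have "\<dots> = h * integral {0..1} (\<lambda>t. (f (h * t + bpt N m))\<^sup>2)"
      by (rule integral_affine_unit[OF f h])
    also have "integral {0..1} (\<lambda>t. (f (h * t + bpt N m))\<^sup>2)
        = integral {0..1} (\<lambda>t. h ^ (2 * q) * (spline_piece q a m t)\<^sup>2)"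
    proof (rule integral_cong)
      fix t :: real assume t: "t \<in> {0..1}"
      have "f (h * t + bpt N m) = h ^ q * spline_piece q a m t"
        using relu_combination_on_cell[OF q, of m N t a] m t by (simp add: f_def s_def h_def)
      then show "(f (h * t + bpt N m))\<^sup>2 = h ^ (2 * q) * (spline_piece q a m t)\<^sup>2"
        by (simp add: power_mult_distrib mult.commute flip: power_mult)
    qed
    finally show "integral {-1 + h * real m..-1 + h * real (Suc m)} (\<lambda>x. (f x)\<^sup>2)
        = h ^ (2 * q + 1) * integral {0..1} (\<lambda>t. (spline_piece q a m t)\<^sup>2)"
      by simp
  qed
  also have "\<dots> = h ^ (2 * q + 1) * spline_energy q N a"
    by (simp add: spline_energy_def sum_distrib_left)
  finally show ?thesis
    by (simp add: quad c_def h_def mult.assoc)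
qed

section \<open>Eigenvalue asymptotics\<close>

lemma eigval_le_spline_energy:
  fixes A :: "real mat"
  assumes A: "A \<in> carrier_mat n n" and sym: "\<And>i j. i < n \<Longrightarrow> j < n \<Longrightarrow> A $$ (i, j) = A $$ (j, i)"
    and form: "\<And>a. quad_form A a = \<kappa> * spline_energy q n a" and \<kappa>: "0 \<le> \<kappa>" and j: "j < n"
  shows "eigvals_desc A ! j \<le> \<kappa> * (2 * real (q + 1)) ^ (2 * q + 2) * (real n / real (j + 1)) ^ (2 * q + 2)"
proof -
  \<comment> \<open>The largest number of blocks for which \<open>q + 1\<close> moment conditions on
    all blocks but the last amount to at most \<open>j\<close> constraints.\<close>
  define B where "B = j div (q + 1) + 1"
  \<comment> \<open>Rounded up, so that the blocks cover all \<open>n\<close> indices.\<close>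
  define L where "L = n div B + 1"
  have B: "0 < B" and L: "0 < L"
    by (auto simp: B_def L_def)
  have "B \<le> j + 1"
    by (simp add: B_def)
  then have Bn: "B \<le> n"
    using j by simp
  have jB: "j + 1 \<le> (q + 1) * B"
  proof -
    have "(q + 1) * B = (q + 1) * (j div (q + 1)) + (q + 1)"
      by (simp add: B_def)
    then show ?thesis
      using mult_div_mod_eq[of "q + 1" j] mod_less_divisor[of "q + 1" j] by linarith
  qed
  have nBL: "n \<le> B * L"
    using dividend_less_div_times[OF B, of n] by (simp add: L_def mult.commute)
  have "real L \<le> real n / real B + 1"
    unfolding L_def using of_nat_div_le_of_nat[of n B, where 'a = real] by simp
  also have "\<dots> \<le> 2 * real n / real B"
    using B Bn by (simp add: field_simps)
  also have "\<dots> \<le> 2 * real n / (real (j + 1) / real (q + 1))"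
  proof (rule divide_left_mono)
    show "real (j + 1) / real (q + 1) \<le> real B"
      using jB by (simp add: field_simps flip: of_nat_mult of_nat_add of_nat_Suc)
  qed (use B in auto)
  also have "\<dots> = 2 * real (q + 1) * (real n / real (j + 1))"
    by simp
  finally have L_le: "real L \<le> 2 * real (q + 1) * (real n / real (j + 1))" .
  \<comment> \<open>The constraint index \<open>c\<close> encodes a block
    \<open>c div (q + 1)\<close> and a moment order \<open>c mod (q + 1)\<close>.\<close>
  define \<phi> where "\<phi> c i = (if i div L = c div (q + 1) then real (i mod L) ^ (c mod (q + 1)) else 0)" for c i
  have "eigvals_desc A ! j \<le> \<kappa> * real L ^ (2 * q + 2)"
  proof (rule eigval_le_of_constraints[OF A sym j])
    fix a :: "nat \<Rightarrow> real"
    assume a: "\<And>c. c < j \<Longrightarrow> (\<Sum>i<n. \<phi> c i * a i) = 0"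
    \<comment> \<open>The blocks may run past \<open>n\<close>, so the coefficients are padded with
      zeros.\<close>
    define a' where "a' i = (if i < n then a i else 0)" for i
    have ext: "(\<Sum>i<B * L. g i * a' i) = (\<Sum>i<n. g i * a i)" for g :: "nat \<Rightarrow> real"
      using nBL by (intro sum.mono_neutral_cong_right) (auto simp: a'_def)
    have "spline_energy q n a = spline_energy q n a'"
      by (intro spline_energy_cong) (simp add: a'_def)
    also have "\<dots> \<le> spline_energy q (B * L) a'"
      by (rule spline_energy_mono[OF nBL])
    also have "\<dots> \<le> real L ^ (2 * q + 2) * (\<Sum>i<B * L. (a' i)\<^sup>2)"
    proof (rule spline_energy_le_of_block_moments)
      fix b \<nu> assume b: "Suc b < B" and \<nu>: "\<nu> \<le> q"
      define c where "c = b * (q + 1) + \<nu>"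
      have c: "c div (q + 1) = b" "c mod (q + 1) = \<nu>"
        using \<nu> by (simp_all add: c_def div_mult_self3 del: add_Suc_right mult_Suc_right)
      have \<phi>_c: "\<phi> c i = (if i div L = b then real (i mod L) ^ \<nu> else 0)" for i
        unfolding \<phi>_def c ..
      have "Suc b \<le> j div (q + 1)"
        using b by (simp add: B_def)
      then have "Suc b * (q + 1) \<le> j"
        by (simp add: less_eq_div_iff_mult_less_eq)
      then have "c < j"
        using \<nu> by (simp add: c_def)
      have "(\<Sum>i<L. a' (b * L + i) * real i ^ \<nu>)
          = (\<Sum>b'<B. if b' = b then \<Sum>i<L. a' (b' * L + i) * real i ^ \<nu> else 0)"
        using b by (simp add: sum.delta)
      also have "\<dots> = (\<Sum>b'<B. \<Sum>i<L. \<phi> c (b' * L + i) * a' (b' * L + i))"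
        by (intro sum.cong refl) (auto simp: \<phi>_c mult.commute intro!: sum.cong sum.neutral)
      also have "\<dots> = (\<Sum>i<n. \<phi> c i * a i)"
        using sum_nat_blocks[of "\<lambda>i. \<phi> c i * a' i" B L] ext[of "\<phi> c"] by simp
      also have "\<dots> = 0"
        by (rule a[OF \<open>c < j\<close>])
      finally show "(\<Sum>i<L. a' (b * L + i) * real i ^ \<nu>) = 0" .
    qed
    also have "(\<Sum>i<B * L. (a' i)\<^sup>2) = (\<Sum>i<n. (a i)\<^sup>2)"
      using nBL by (intro sum.mono_neutral_cong_right) (auto simp: a'_def)
    finally show "quad_form A a \<le> \<kappa> * real L ^ (2 * q + 2) * (\<Sum>i<n. (a i)\<^sup>2)"
      unfolding form mult.assoc using \<kappa> by (rule mult_left_mono)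
  qed
  also have "\<dots> \<le> \<kappa> * (2 * real (q + 1) * (real n / real (j + 1))) ^ (2 * q + 2)"
    using \<kappa> L_le by (intro mult_left_mono power_mono) auto
  also have "\<dots> = \<kappa> * (2 * real (q + 1)) ^ (2 * q + 2) * (real n / real (j + 1)) ^ (2 * q + 2)"
    by (simp only: power_mult_distrib mult.assoc)
  finally show ?thesis .
qed

lemma eigval_ge_uniform:
  fixes A :: "real mat"
  assumes A: "A \<in> carrier_mat n n" and sym: "\<And>i j. i < n \<Longrightarrow> j < n \<Longrightarrow> A $$ (i, j) = A $$ (j, i)"
    and ge: "\<And>a. \<alpha> * (\<Sum>i<n. (a i)\<^sup>2) \<le> quad_form A a" and j: "j < n"
  shows "\<alpha> \<le> eigvals_desc A ! j"
proof (rule eigval_ge_of_test_space[OF A sym j, where w = "\<lambda>k i. if i = k then 1 else 0"])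
  fix x :: "nat \<Rightarrow> real"
  let ?a = "\<lambda>i. \<Sum>k\<le>j. x k * (if i = k then 1 else 0)"
  have a: "?a i = (if i \<le> j then x i else 0)" for i
    by (simp add: if_distrib[of "\<lambda>y. _ * y"] sum.delta' cong: if_cong)
  assume "(\<Sum>i<n. (?a i)\<^sup>2) = 0"
  then have "\<forall>i<n. ?a i = 0"
    by (subst (asm) sum_nonneg_eq_0_iff) auto
  then show "\<forall>k\<le>j. x k = 0"
    using j unfolding a by (metis le_less_trans)
qed (assumption | rule ge)+

text \<open>The test space is spanned by \<open>j + 1\<close> bumps on disjoint blocks of length
  \<open>(q + 2) * l\<close>. Its vectors all have the Rayleigh bound of a single bump, since energy
  and norm scale with the same sum of squares.\<close>

lemma eigval_ge_spline_energy_bump: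
  fixes A :: "real mat"
  assumes A: "A \<in> carrier_mat n n" and sym: "\<And>i j. i < n \<Longrightarrow> j < n \<Longrightarrow> A $$ (i, j) = A $$ (j, i)"
    and form: "\<And>a. quad_form A a = \<kappa> * spline_energy q n a" and \<kappa>: "0 \<le> \<kappa>" and j: "j < n"
    and l: "2 \<le> l" "(j + 1) * ((q + 2) * l) \<le> n"
  shows "\<kappa> * real l ^ (2 * q + 2) / (2 ^ (2 * q + 3) * real (2 * q + 3) * (real (q + 1))\<^sup>2
      * (\<Sum>k\<le>Suc q. (real (Suc q choose k))\<^sup>2)) \<le> eigvals_desc A ! j"
proof -
  define L where "L = (q + 2) * l"
  define E where "E = spline_energy q L (bump q l)"
  define S where "S = (\<Sum>k\<le>Suc q. (real (Suc q choose k))\<^sup>2)"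
  define D where "D = 2 ^ (2 * q + 3) * real (2 * q + 3) * (real (q + 1))\<^sup>2"
  have l0: "0 < l" and L: "0 < L"
    using l by (auto simp: L_def)
  have D: "0 < D"
    by (auto simp: D_def)
  have "1 \<le> S"
    unfolding S_def using member_le_sum[of 0 "{..Suc q}" "\<lambda>k. (real (Suc q choose k))\<^sup>2"] by simp
  then have S: "0 < S"
    by simp
  have E: "real l ^ (2 * q + 3) \<le> D * E"
    unfolding D_def E_def L_def by (rule spline_energy_bump_ge[OF l(1)])
  define w where "w k i = (if i div L = k then bump q l (i mod L) else 0)" for k i
  have facts: "(\<Sum>b<j + 1. (x b)\<^sup>2) * E \<le> spline_energy q n (\<lambda>i. \<Sum>k\<le>j. x k * w k i)"
    "(\<Sum>i<n. (\<Sum>k\<le>j. x k * w k i)\<^sup>2) = (\<Sum>b<j + 1. (x b)\<^sup>2) * (real l * S)" for x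
  proof -
    define x' where "x' b = (if b < j + 1 then x b else 0)" for b
    have x': "j + 1 \<le> b \<Longrightarrow> x' b = 0" for b
      by (simp add: x'_def)
    have a: "(\<lambda>i. \<Sum>k\<le>j. x k * w k i) = (\<lambda>i. x' (i div L) * bump q l (i mod L))"
    proof
      fix i
      have "(\<Sum>k\<le>j. x k * w k i) = (\<Sum>k\<le>j. if i div L = k then x k * bump q l (i mod L) else 0)"
        by (intro sum.cong) (auto simp: w_def)
      then show "(\<Sum>k\<le>j. x k * w k i) = x' (i div L) * bump q l (i mod L)"
        by (simp add: x'_def sum.delta)
    qed
    have sq: "(\<Sum>b<j + 1. (x' b)\<^sup>2) = (\<Sum>b<j + 1. (x b)\<^sup>2)"
      by (intro sum.cong) (auto simp: x'_def)
    note sup = spline_energy_bump_superposition[OF l0, of "j + 1" x' q n, OF x' l(2), folded L_def, unfolded sq]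
    show "(\<Sum>b<j + 1. (x b)\<^sup>2) * E \<le> spline_energy q n (\<lambda>i. \<Sum>k\<le>j. x k * w k i)"
      using sup(1) unfolding a E_def .
    show "(\<Sum>i<n. (\<Sum>k\<le>j. x k * w k i)\<^sup>2) = (\<Sum>b<j + 1. (x b)\<^sup>2) * (real l * S)"
      using sup(2) bump_square_sum[of q l] fun_cong[OF a] by (simp add: S_def L_def)
  qed
  have "\<kappa> * real l ^ (2 * q + 2) / (D * S) \<le> eigvals_desc A ! j"
  proof (rule eigval_ge_of_test_space[OF A sym j, where w = w])
    fix x :: "nat \<Rightarrow> real"
    show "\<kappa> * real l ^ (2 * q + 2) / (D * S) * (\<Sum>i<n. (\<Sum>k\<le>j. x k * w k i)\<^sup>2)
        \<le> quad_form A (\<lambda>i. \<Sum>k\<le>j. x k * w k i)"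
    proof -
      have "\<kappa> * real l ^ (2 * q + 2) / (D * S) * (\<Sum>i<n. (\<Sum>k\<le>j. x k * w k i)\<^sup>2)
          = \<kappa> * ((\<Sum>b<j + 1. (x b)\<^sup>2) * (real l ^ (2 * q + 3) / D))"
      proof -
        have "\<kappa> * P / (D * S) * (s * (real l * S)) = \<kappa> * (s * (real l * P / D))" for s P
          using S by simp
        moreover have "real l ^ (2 * q + 3) = real l * real l ^ (2 * q + 2)"
          by (simp add: eval_nat_numeral)
        ultimately show ?thesis
          by (simp only: facts(2))
      qed
      also have "\<dots> \<le> \<kappa> * ((\<Sum>b<j + 1. (x b)\<^sup>2) * E)"
        using \<kappa> D E by (intro mult_left_mono sum_nonneg) (auto simp: field_simps)
      also have "\<dots> \<le> \<kappa> * spline_energy q n (\<lambda>i. \<Sum>k\<le>j. x k * w k i)"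
        by (rule mult_left_mono[OF facts(1) \<kappa>])
      finally show ?thesis
        by (simp add: form)
    qed
    assume "(\<Sum>i<n. (\<Sum>k\<le>j. x k * w k i)\<^sup>2) = 0"
    then have "(\<Sum>b<j + 1. (x b)\<^sup>2) = 0"
      unfolding facts(2) using l0 S by simp
    then show "\<forall>k\<le>j. x k = 0"
      by (subst (asm) sum_nonneg_eq_0_iff) auto
  qed
  then show ?thesis
    by (simp only: D_def S_def)
qed

text \<open>Either \<open>j + 1\<close> bumps with \<open>l \<ge> 2\<close> fit, or
  \<open>n / (j + 1)\<close> is bounded and the uniform bound suffices. The constant precedes the
  quantifiers over \<open>n\<close>, \<open>j\<close> and \<open>\<kappa>\<close>, so it depends
  only on \<open>q\<close>.\<close>

lemma eigval_ge_spline_energy: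
  "\<exists>c>0. \<forall>n j \<kappa> A. A \<in> carrier_mat n n \<longrightarrow> (\<forall>i<n. \<forall>j<n. A $$ (i, j) = A $$ (j, i)) \<longrightarrow>
    (\<forall>a. quad_form A a = \<kappa> * spline_energy q n a) \<longrightarrow> 0 \<le> \<kappa> \<longrightarrow> j < n \<longrightarrow>
    \<kappa> * c * (real n / real (j + 1)) ^ (2 * q + 2) \<le> eigvals_desc A ! j"
proof -
  obtain C0 where C0: "0 < C0" and energy: "\<And>N a. (\<Sum>i<N. (a i)\<^sup>2) \<le> C0 * spline_energy q N a"
    using sum_squares_le_spline_energy[of q] by blast
  define C1 where "C1 = 2 ^ (2 * q + 3) * real (2 * q + 3) * (real (q + 1))\<^sup>2
      * (\<Sum>k\<le>Suc q. (real (Suc q choose k))\<^sup>2)"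
  have "0 < (\<Sum>k\<le>Suc q. (real (Suc q choose k))\<^sup>2)"
    by (rule sum_pos) auto
  then have C1: "0 < C1"
    unfolding C1_def by (intro mult_pos_pos) auto
  \<comment> \<open>\<open>R\<close> is chosen so that \<open>n / (j + 1)\<close> is at most
    \<open>R * l\<close> when \<open>l \<ge> 2\<close> and at most \<open>R\<close>
    otherwise.\<close>
  define R where "R = 2 * real (q + 2)"
  define M where "M = R ^ (2 * q + 2) * max C0 C1"
  have R0: "R \<noteq> 0"
    by (simp add: R_def)
  have R: "0 < R ^ (2 * q + 2)"
    by (simp add: R_def)
  have M: "0 < M"
    using R C0 by (simp add: M_def)
  show ?thesis
  proof (intro exI[of _ "1 / M"] conjI allI impI)
    fix n j :: nat and \<kappa> :: real and A :: "real mat"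
    assume A: "A \<in> carrier_mat n n" and sym: "\<forall>i<n. \<forall>j<n. A $$ (i, j) = A $$ (j, i)"
      and form: "\<forall>a. quad_form A a = \<kappa> * spline_energy q n a" and \<kappa>: "0 \<le> \<kappa>" and j: "j < n"
    define e where "e = 2 * q + 2"
    define l where "l = n div ((j + 1) * (q + 2))"
    have "n < (j + 1) * (q + 2) + l * ((j + 1) * (q + 2))"
      unfolding l_def by (rule dividend_less_div_times) simp
    then have "n < (q + 2) * (l + 1) * (j + 1)"
      by (simp add: algebra_simps)
    then have "real n < real ((q + 2) * (l + 1) * (j + 1))"
      by (simp only: of_nat_less_iff)
    then have n_lt: "real n / real (j + 1) < real (q + 2) * (real l + 1)"
      by (simp add: pos_divide_less_eq algebra_simps)
    \<comment> \<open>Both cases end in a bound \<open>\<kappa> * y ^ e / C\<close>: with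
      \<open>y = l\<close> and \<open>C1\<close> for bumps, with \<open>y = 1\<close> and
      \<open>C0\<close> for the uniform bound.\<close>
    have reduce: "\<kappa> * (1 / M) * (real n / real (j + 1)) ^ e \<le> \<kappa> * y ^ e / C"
      if C: "0 < C" "C \<le> max C0 C1" and y: "0 \<le> y" "real n / real (j + 1) \<le> R * y" for y C
    proof -
      have "(real n / real (j + 1)) ^ e \<le> (R * y) ^ e"
        using y(2) by (intro power_mono) auto
      also have "\<dots> = R ^ e * y ^ e"
        by (rule power_mult_distrib)
      finally have "(real n / real (j + 1)) ^ e / M \<le> R ^ e * y ^ e / M"
        using M by (intro divide_right_mono) auto
      also have "\<dots> = y ^ e / max C0 C1"
        unfolding M_def e_def[symmetric] using R0 by simp
      also have "\<dots> \<le> y ^ e / C"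
        using C y(1) by (intro divide_left_mono) auto
      finally have "\<kappa> * ((real n / real (j + 1)) ^ e / M) \<le> \<kappa> * (y ^ e / C)"
        by (rule mult_left_mono[OF _ \<kappa>])
      then show ?thesis
        by simp
    qed
    have "\<kappa> * (1 / M) * (real n / real (j + 1)) ^ e \<le> eigvals_desc A ! j"
    proof (cases "2 \<le> l")
      case True
      have "(j + 1) * ((q + 2) * l) \<le> n"
        unfolding l_def mult.assoc[symmetric] by (rule times_div_less_eq_dividend)
      then have "\<kappa> * real l ^ e / C1 \<le> eigvals_desc A ! j"
        unfolding C1_def e_def using sym form
        by (intro eigval_ge_spline_energy_bump[OF A _ _ \<kappa> j True]) auto
      moreover have "real n / real (j + 1) \<le> R * real l"
      proof -
        have "real (q + 2) * (real l + 1) \<le> real (q + 2) * (2 * real l)"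
          using True by (intro mult_left_mono) auto
        also have "\<dots> = R * real l"
          by (simp add: R_def)
        finally show ?thesis
          using n_lt by linarith
      qed
      ultimately show ?thesis
        using reduce[OF C1, of "real l"] by simp
    next
      case False
      have "\<kappa> / C0 \<le> eigvals_desc A ! j"
      proof (rule eigval_ge_uniform[OF A _ _ j])
        fix a :: "nat \<Rightarrow> real"
        have "(\<Sum>i<n. (a i)\<^sup>2) / C0 \<le> spline_energy q n a"
          using energy[of a n] C0 by (simp add: field_simps)
        then have "\<kappa> * ((\<Sum>i<n. (a i)\<^sup>2) / C0) \<le> \<kappa> * spline_energy q n a"
          by (rule mult_left_mono[OF _ \<kappa>])
        then show "\<kappa> / C0 * (\<Sum>i<n. (a i)\<^sup>2) \<le> quad_form A a"
          by (simp add: form)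
      qed (use sym in auto)
      moreover have "real n / real (j + 1) \<le> R * 1"
      proof -
        have "real (q + 2) * (real l + 1) \<le> real (q + 2) * 2"
          using False by (intro mult_left_mono) auto
        also have "\<dots> = R * 1"
          by (simp add: R_def)
        finally show ?thesis
          using n_lt by linarith
      qed
      ultimately show ?thesis
        using reduce[OF C0, of 1] by simp
    qed
    then show "\<kappa> * (1 / M) * (real n / real (j + 1)) ^ (2 * q + 2) \<le> eigvals_desc A ! j"
      by (simp only: e_def)
  qed (use M in simp)
qed

text \<open>Both eigenvalue bounds carry the same factor \<open>\<kappa> N\<close>, which depends on
  \<open>N\<close> but not on \<open>j\<close> and cancels in the ratio; the constants become
  \<open>c / C\<close> and \<open>C / c\<close>.\<close>

theorem theorem3:
  fixes p k :: nat
  assumes "p \<ge> 1" and "k < p"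
  defines "lam \<equiv> \<lambda>N j. eigvals_desc (gram p k N) ! (j - 1)"
    and "e \<equiv> 2 + 2 * (p - k)"
  shows "(\<exists>c C N0. c > 0 \<and> C > 0 \<and> (\<forall>N\<ge>N0. \<forall>j\<in>{1..N}.
            c * (real N / real j) ^ e \<le> lam N j / lam N N \<and>
            lam N j / lam N N \<le> C * (real N / real j) ^ e))
       \<and> (\<exists>c C N0. c > 0 \<and> C > 0 \<and> (\<forall>N\<ge>N0.
            c * real N ^ e \<le> lam N 1 / lam N N \<and>
            lam N 1 / lam N N \<le> C * real N ^ e))"
proof -
  define q where "q = p - k"
  have e: "e = 2 * q + 2"
    by (simp add: e_def q_def)
  obtain c where c: "0 < c" and lower: "\<forall>n j \<kappa> A. A \<in> carrier_mat n n \<longrightarrow>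
    (\<forall>i<n. \<forall>j<n. A $$ (i, j) = A $$ (j, i)) \<longrightarrow>
    (\<forall>a. quad_form A a = \<kappa> * spline_energy q n a) \<longrightarrow> 0 \<le> \<kappa> \<longrightarrow> j < n \<longrightarrow>
    \<kappa> * c * (real n / real (j + 1)) ^ (2 * q + 2) \<le> eigvals_desc A ! j"
    using eigval_ge_spline_energy[of q] by blast
  define C where "C = (2 * real (q + 1)) ^ (2 * q + 2)"
  have C: "0 < C"
    by (simp add: C_def)
  define \<kappa> where "\<kappa> N = (fact p / fact q)\<^sup>2 * (2 / real N) ^ (2 * q + 1)" for N
  have \<kappa>: "0 < \<kappa> N" if "0 < N" for N
    using that by (simp add: \<kappa>_def)
  have form: "quad_form (gram p k N) a = \<kappa> N * spline_energy q N a" if "0 < N" for N a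
    unfolding \<kappa>_def q_def by (rule quad_form_gram[OF assms(2) that])
  have bounds: "\<kappa> N * c * (real N / real j) ^ e \<le> lam N j" "lam N j \<le> \<kappa> N * C * (real N / real j) ^ e"
    if "j \<in> {1..N}" for N j
  proof -
    have j: "j - 1 < N" "0 < N" and j1: "j - 1 + 1 = j"
      using that by auto
    show "\<kappa> N * c * (real N / real j) ^ e \<le> lam N j"
      using lower[rule_format, of "gram p k N" N "\<kappa> N" "j - 1"] gram_carrier gram_sym form[OF j(2)] \<kappa>[OF j(2)] j(1)
      unfolding lam_def e j1 by simp
    show "lam N j \<le> \<kappa> N * C * (real N / real j) ^ e"
      using eigval_le_spline_energy[OF gram_carrier gram_sym form[OF j(2)] less_imp_le[OF \<kappa>[OF j(2)]] j(1)]
      unfolding lam_def e j1 C_def by simp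
  qed
  have ratio: "c / C * (real N / real j) ^ e \<le> lam N j / lam N N"
    "lam N j / lam N N \<le> C / c * (real N / real j) ^ e" if j: "j \<in> {1..N}" for N j
  proof -
    have N: "N \<in> {1..N}" "0 < N"
      using j by auto
    define t where "t = (real N / real j) ^ e"
    have t: "0 < t"
      using j by (simp add: t_def)
    have lamN: "\<kappa> N * c \<le> lam N N" "lam N N \<le> \<kappa> N * C"
      \<comment> \<open>For \<open>j = N\<close> the power of \<open>N / j\<close> is 1, so the
        smallest eigenvalue is comparable to \<open>\<kappa> N\<close>.\<close>
      using bounds[OF N(1)] N by simp_all
    have pos: "0 < \<kappa> N * c"
      using \<kappa>[OF N(2)] c by simp
    then have lamN_pos: "0 < lam N N"
      using lamN(1) by linarith
    have num: "0 \<le> \<kappa> N * c * t"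
      using pos t by simp
    have "c / C * t = (\<kappa> N * c * t) / (\<kappa> N * C)"
      using \<kappa>[OF N(2)] by simp
    also have "\<dots> \<le> lam N j / lam N N"
      using bounds(1)[OF j] lamN lamN_pos num unfolding t_def[symmetric]
      by (intro frac_le) linarith+
    finally show "c / C * (real N / real j) ^ e \<le> lam N j / lam N N"
      unfolding t_def .
    have "lam N j / lam N N \<le> (\<kappa> N * C * t) / (\<kappa> N * c)"
      using bounds(2)[OF j] lamN pos t \<kappa>[OF N(2)] C unfolding t_def[symmetric]
      by (intro frac_le) auto
    also have "\<dots> = C / c * t"
      using \<kappa>[OF N(2)] by simp
    finally show "lam N j / lam N N \<le> C / c * (real N / real j) ^ e"
      unfolding t_def .
  qed
  have pos: "0 < c / C" "0 < C / c"
    using c C by auto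
  show ?thesis
  proof
    show "\<exists>c C N0. c > 0 \<and> C > 0 \<and> (\<forall>N\<ge>N0. \<forall>j\<in>{1..N}.
            c * (real N / real j) ^ e \<le> lam N j / lam N N \<and>
            lam N j / lam N N \<le> C * (real N / real j) ^ e)"
      using ratio pos by blast
    \<comment> \<open>The condition number is the case \<open>j = 1\<close>, an admissible index
      once \<open>N \<ge> 1\<close>.\<close>
    have "\<forall>N\<ge>1. c / C * real N ^ e \<le> lam N 1 / lam N N \<and> lam N 1 / lam N N \<le> C / c * real N ^ e"
      using ratio[of 1] by simp
    then show "\<exists>c C N0. c > 0 \<and> C > 0 \<and> (\<forall>N\<ge>N0.
            c * real N ^ e \<le> lam N 1 / lam N N \<and>
            lam N 1 / lam N N \<le> C * real N ^ e)"
      using pos by blast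
  qed
qed

end
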